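(* Let $V_*\in\mathbb{V}_k$ be a solution to the NEPv $A(P)V=V\Lambda$, let $P_*=V_*V_*^{\mathrm H}$, and assume $$g=\lambda_{k+1}(A(P_* ))-\lambda_k(A(P_* ))>0 .$$ Let $\xi>0$ and let $\delta$ and $d$ be the quantities defined in the context (by suprema over $\mathbb{P}_\xi$). If $$\delta<\tfrac12 g-d,$$ then the perturbed NEPv $\widetilde A(\widetilde P)\widetilde V=\widetilde V\widetilde\Lambda$ has a solution $\widetilde V_*\in\mathbb{V}_{\xi_*}$, i.e. a solution $\widetilde V_*\in\mathbb{V}_k$ with $\|\sin\Theta(\mathcal R(\widetilde V_* ),\mathcal R(V_* ))\|_2\le \xi_*$, where $$\xi_*=\frac{2\delta}{g-d-\delta+\sqrt{(g-d-\delta)^2-4d\delta}} .$$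
   Context: Let $1\le k<n$. $\|\cdot\|_2$ is the matrix 2-norm. Eigenvalues of a Hermitian $H\in\mathbb{C}^{n\times n}$ are ordered $\lambda_1(H)\le\dots\le\lambda_n(H)$. Let $\mathbb{V}_k=\{V\in\mathbb{C}^{n\times k}: V^{\mathrm H}V=I_k\}$ and $\mathbb{P}_k=\{VV^{\mathrm H}: V\in\mathbb{V}_k\}$. $\mathcal R(V)$ is the column space of $V$. For $k$-dimensional subspaces $\mathcal X,\mathcal Y$ of $\mathbb{C}^n$ with orthonormal bases given by the columns of $X,Y$, $\Theta(\mathcal X,\mathcal Y)=\mathrm{diag}(\theta_1,\dots,\theta_k)$ with $\theta_j=\arccos\sigma_j\in[0,\pi/2]$, where the $\sigma_j$ are the singular values of $X^{\mathrm H}Y$ (canonical angles). The NEPv (eigenvector-dependent nonlinear eigenvalue problem): $A(P)=A_0+A_1(P)+A_2(P)$ is a continuous Hermitian-matrix-valued function of $P\in\mathbb{P}_k$, where $A_0\in\mathbb{C}^{n\times n}$ is a constant Hermitian matrix, $A_1(P)$ is Hermitian and a homogeneous linear function of $P$, and $A_2(P)$ is Hermitian and a nonlinear function of $P$. A solution of $A(P)V=V\Lambda$ is a $V\in\mathbb{V}_k$ such that, with $P=VV^{\mathrm H}$ and $\Lambda=V^{\mathrm H}A(P)V$, one has $A(P)V=V\Lambda$ and the eigenvalues of $\Lambda$ are the $k$ smallest eigenvalues of $A(P)$ (with multiplicity). The perturbed NEPv: $\widetilde A(P)=\widetilde A_0+\widetilde A_1(P)+\widetilde A_2(P)$ is a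 continuous Hermitian-matrix-valued function of $P\in\mathbb{P}_k$, with $\widetilde A_0$ a constant Hermitian matrix and $\widetilde A_1(P),\widetilde A_2(P)$ Hermitian (perturbations of $A_1,A_2$). A solution of $\widetilde A(\widetilde P)\widetilde V=\widetilde V\widetilde\Lambda$ is defined in the same way: $\widetilde V\in\mathbb{V}_k$, $\widetilde P=\widetilde V\widetilde V^{\mathrm H}$, $\widetilde\Lambda=\widetilde V^{\mathrm H}\widetilde A(\widetilde P)\widetilde V$, the eigenvalues of $\widetilde\Lambda$ being the $k$ smallest eigenvalues of $\widetilde A(\widetilde P)$. For a real number $t\ge0$ (in particular $t=\xi$ or $t=\xi_*$): $\mathbb{V}_t=\{V\in\mathbb{V}_k:\|\sin\Theta(\mathcal R(V),\mathcal R(V_* ))\|_2\le t\}$ and $\mathbb{P}_t=\{VV^{\mathrm H}:V\in\mathbb{V}_t\}$. (The subscript $k$ in $\mathbb{V}_k,\mathbb{P}_k$ always refers to the full sets above; other subscripts refer to these neighbourhoods.) For any $\xi>0$: $\delta_0=\|\widetilde A_0-A_0\|_2$; $\delta_i=\sup_{P\in\mathbb{P}_\xi}\|\widetilde A_i(P)-A_i(P)\|_2$ and $d_i=\sup_{P\in\mathbb{P}_\xi,\,P\ne P_*}\|A_i(P)-A_i(P_* )\|_2/\|P-P_*\|_2$ for $i=1,2$; $\delta=\delta_0+\delta_1+\delta_2$ and $d=d_1+d_2$.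
   Formalization: The condition ξ_* ≤ ξ is added (automatic if ξ ≥ 1); without it the claim is false, since δ does not control the perturbation outside P_ξ: e.g. n=2, k=1, ξ=1/10, A=diag(0,2), Ã=[[0,b],[b,2]] with b=1/2+10·max(0,P_22−1/100) has no solution within ξ_*=1/3. *)

theory Defs
  imports "HOL-Analysis.Analysis"
begin

definition ctranspose :: "complex^'m^'n \<Rightarrow> complex^'n^'m" where
  "ctranspose A = (\<chi> i j. cnj (A $ j $ i))"

definition Hermitian :: "complex^'n^'n \<Rightarrow> bool" where
  "Hermitian A \<longleftrightarrow> ctranspose A = A"

text \<open>The matrix 2-norm is the operator norm with respect to the Euclidean norms.  (The type
  class instance \<open>norm\<close> on matrices is the Frobenius norm.)\<close>

definition norm2 :: "('a::real_normed_algebra_1)^'m^'n \<Rightarrow> real" where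
  "norm2 A = onorm ((*v) A)"

definition charpol :: "complex^'n^'n \<Rightarrow> complex poly" where
  "charpol A = det (\<chi> i j. (if i = j then [:0, 1:] else 0) - [:A $ i $ j:])"

text \<open>The eigenvalues with algebraic multiplicity, in ascending order.  This is only meant for
  matrices with real spectrum, where taking the real part changes nothing.\<close>

definition eigs :: "complex^'n^'n \<Rightarrow> real list" where
  "eigs H = sorted_list_of_multiset (image_mset Re (proots (charpol H)))"

definition eig :: "complex^'n^'n \<Rightarrow> nat \<Rightarrow> real"  \<comment> \<open>indices start at 1\<close> where
  "eig H j = eigs H ! (j - 1)"

definition singvals :: "complex^'k^'k \<Rightarrow> real list" where
  "singvals M = map sqrt (eigs (ctranspose M ** M))"

definition Vk :: "(complex^'k^'n) set" where
  "Vk = {V. ctranspose V ** V = mat 1}"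

definition projmat :: "complex^'k^'n \<Rightarrow> complex^'n^'n" where
  "projmat V = V ** ctranspose V"

text \<open>The number of columns is not visible in the type of a projection, so it is passed as a
  type argument.\<close>

definition Pk :: "'k::finite itself \<Rightarrow> (complex^'n^'n) set" where
  "Pk _ = projmat ` (Vk :: (complex^'k^'n) set)"

definition colspace :: "complex^'k^'n \<Rightarrow> (complex^'n) set" where
  "colspace V = range ((*v) V)"

text \<open>An arbitrary orthonormal basis of a \<open>CARD('k)\<close>-dimensional subspace, as the columns of a
  matrix.  The canonical angles do not depend on the choice.\<close>

definition onbasis :: "(complex^'n) set \<Rightarrow> complex^'k^'n" where
  "onbasis S = (SOME X. X \<in> Vk \<and> colspace X = S)"

definition canon_angles :: "'k::finite itself \<Rightarrow> (complex^'n) set \<Rightarrow> (complex^'n) set \<Rightarrow> real list" where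
  "canon_angles _ S T =
     map arccos (singvals (ctranspose (onbasis S :: complex^'k^'n) ** (onbasis T :: complex^'k^'n)))"

text \<open>Diagonal matrix with prescribed diagonal entries; the enumeration of the index type by
  \<open>{..<CARD('k)}\<close> is an arbitrary fixed one, which only affects the order of the entries.\<close>

definition diag_of_list :: "real list \<Rightarrow> real^'k^'k" where
  "diag_of_list xs = (\<chi> i j. if i = j then xs ! to_nat_on (UNIV :: 'k set) i else 0)"

definition sin_Theta :: "(complex^'n) set \<Rightarrow> (complex^'n) set \<Rightarrow> real^'k^'k" where
  "sin_Theta S T = diag_of_list (map sin (canon_angles TYPE('k) S T))"

definition Vnbhd :: "complex^'k^'n \<Rightarrow> real \<Rightarrow> (complex^'k^'n) set" where
  "Vnbhd Vs t = {V \<in> Vk. norm2 (sin_Theta (colspace V) (colspace Vs) :: real^'k^'k) \<le> t}"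

definition Pnbhd :: "complex^'k^'n \<Rightarrow> real \<Rightarrow> (complex^'n^'n) set" where
  "Pnbhd Vs t = projmat ` Vnbhd Vs t"

definition NEPv_solution :: "(complex^'n^'n \<Rightarrow> complex^'n^'n) \<Rightarrow> complex^'k^'n \<Rightarrow> bool" where
  "NEPv_solution A V \<longleftrightarrow> V \<in> Vk \<and>
     (let P = projmat V; L = ctranspose V ** A P ** V
      in A P ** V = V ** L \<and> eigs L = take CARD('k) (eigs (A P)))"

text \<open>Both suprema are taken in the extended reals, since they may be infinite.  Taken over
  \<open>Pnbhd Vs \<xi>\<close>, they say nothing about the perturbed problem outside that
  neighbourhood; hence the explicit condition \<open>\<xi>s \<le> \<xi>\<close> in the theorem, without
  which its conclusion can fail.\<close>

definition sup_diff ::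
    "(complex^'n^'n) set \<Rightarrow> (complex^'n^'n \<Rightarrow> complex^'n^'n) \<Rightarrow> (complex^'n^'n \<Rightarrow> complex^'n^'n) \<Rightarrow> ereal"
  where "sup_diff S F G = (SUP P\<in>S. ereal (norm2 (F P - G P)))"

definition sup_quot ::
    "(complex^'n^'n) set \<Rightarrow> (complex^'n^'n \<Rightarrow> complex^'n^'n) \<Rightarrow> complex^'n^'n \<Rightarrow> ereal"
  where "sup_quot S F Q = (SUP P\<in>S - {Q}. ereal (norm2 (F P - F Q) / norm2 (P - Q)))"

end

theory Submission
  imports Defs
begin

text \<open>For a Hermitian \<open>H\<close> within \<open>r = \<delta> + d \<xi>\<^sub>*\<close> of \<open>A(P\<^sub>*)\<close> in the 2-norm, let \<open>\<Phi> H\<close> be the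
  projection onto the span of the eigenvectors for the \<open>k\<close> smallest eigenvalues of \<open>H\<close>.  Since
  \<open>2 r < g\<close>, Weyl's inequality keeps a gap open, and the Davis-Kahan theorem shows that \<open>\<Phi>\<close> is
  Lipschitz and that \<open>\<Phi> H\<close> has distance at most \<open>r / (g - r) = \<xi>\<^sub>*\<close> from \<open>P\<^sub>*\<close>.  The definitions of
  \<open>\<delta>\<close> and \<open>d\<close> then put the value of the perturbed function at \<open>\<Phi> H\<close> back within \<open>r\<close> of
  \<open>A(P\<^sub>*)\<close>.  Hence Brouwer's theorem yields a fixed point \<open>H\<close> on this compact convex ball, and the
  eigenvectors of \<open>H\<close> solve the perturbed problem.\<close>

section \<open>Spectral theory of Hermitian matrices\<close>

text \<open>Minimise \<open>x \<bullet> T x\<close> over the compact unit sphere of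
  \<open>W\<close>. The residual \<open>w = T v - \<mu> v\<close> at a minimiser again lies in
  \<open>W\<close>, and the first variation in the direction \<open>w\<close> is a multiple of
  \<open>w \<bullet> w\<close>, so \<open>w = 0\<close>. Working over real Euclidean spaces covers
  complex vectors as well.\<close>

lemma selfadjoint_Min_eigenvector:
  fixes T :: "'a::euclidean_space \<Rightarrow> 'a"
  assumes T: "linear T" "\<And>x y. x \<bullet> T y = T x \<bullet> y"
    and W: "subspace W" "\<And>x. x \<in> W \<Longrightarrow> T x \<in> W" "z \<in> W" "z \<noteq> 0"
  obtains v \<mu> where "v \<in> W" "norm v = 1" "T v = \<mu> *\<^sub>R v"
    "\<And>x. x \<in> W \<Longrightarrow> \<mu> * (norm x)\<^sup>2 \<le> x \<bullet> T x"
proof -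
  interpret linear T by fact
  have "compact (W \<inter> sphere 0 1)"
    by (intro closed_Int_compact closed_subspace W compact_sphere)
  moreover have "z /\<^sub>R norm z \<in> W \<inter> sphere 0 1"
    using W by (auto simp: subspace_scale)
  then have "W \<inter> sphere 0 1 \<noteq> {}" by blast
  moreover have "continuous_on (W \<inter> sphere 0 1) (\<lambda>x. x \<bullet> T x)"
    by (intro continuous_intros linear_continuous_on T[unfolded linear_conv_bounded_linear])
  ultimately obtain v where v: "v \<in> W" "norm v = 1"
    and min: "\<And>x. x \<in> W \<Longrightarrow> norm x = 1 \<Longrightarrow> v \<bullet> T v \<le> x \<bullet> T x"
    using continuous_attains_inf[of "W \<inter> sphere 0 1" "\<lambda>x. x \<bullet> T x"]
    by (metis IntE IntI mem_sphere_0)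
  define \<mu> where "\<mu> = v \<bullet> T v"
  have le: "\<mu> * (norm x)\<^sup>2 \<le> x \<bullet> T x" if "x \<in> W" for x
  proof (cases "x = 0")
    case False
    have "\<mu> \<le> (x /\<^sub>R norm x) \<bullet> T (x /\<^sub>R norm x)"
      unfolding \<mu>_def using that W False by (intro min) (auto simp: subspace_scale)
    also have "\<dots> = (x \<bullet> T x) / (norm x)\<^sup>2"
      by (simp add: scale power2_eq_square divide_inverse)
    finally show ?thesis using False by (simp add: pos_le_divide_eq)
  qed (simp add: zero)
  define w where "w = T v - \<mu> *\<^sub>R v"
  have wW: "w \<in> W" unfolding w_def using v W by (auto simp: subspace_diff subspace_scale)
  define c where "c = w \<bullet> T w - \<mu> * (w \<bullet> w)"
  \<comment> \<open>The form \<open>x \<bullet> T x - \<mu> (x \<bullet> x)\<close> is nonnegative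
    on \<open>W\<close> and vanishes at \<open>v\<close>; expanded at \<open>v + t w\<close> it has
    no constant term.\<close>
  have q: "0 \<le> 2 * t * (w \<bullet> w) + t\<^sup>2 * c" for t
  proof -
    have "v + t *\<^sub>R w \<in> W" using v wW W by (auto simp: subspace_add subspace_scale)
    from le[OF this] have "0 \<le> (v + t *\<^sub>R w) \<bullet> T (v + t *\<^sub>R w) - \<mu> * ((v + t *\<^sub>R w) \<bullet> (v + t *\<^sub>R w))"
      by (simp add: power2_norm_eq_inner)
    also have "\<dots> = (v \<bullet> T v - \<mu> * (v \<bullet> v)) + 2 * t * (w \<bullet> (T v - \<mu> *\<^sub>R v)) + t\<^sup>2 * c"
      using T(2)[of v w]
      by (simp add: c_def add scale inner_simps power2_norm_eq_inner inner_commute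
          algebra_simps power2_eq_square)
    also have "v \<bullet> T v - \<mu> * (v \<bullet> v) = 0"
      using v by (simp add: \<mu>_def flip: power2_norm_eq_inner)
    finally show ?thesis by (simp add: w_def)
  qed
  have "w \<bullet> w = 0"
  proof (rule ccontr)
    assume "w \<bullet> w \<noteq> 0"
    then have pos: "w \<bullet> w > 0" by simp
    \<comment> \<open>This \<open>t\<close> is small enough for the linear term to dominate:
      \<open>t * c \<le> w \<bullet> w\<close>, so the form is negative at
      \<open>v - t w\<close>.\<close>
    define t where "t = (w \<bullet> w) / (\<bar>c\<bar> + 1)"
    have tpos: "t > 0" unfolding t_def using pos by (simp add: add_nonneg_pos)
    have "t * c \<le> t * (\<bar>c\<bar> + 1)" using tpos by (intro mult_left_mono) auto
    also have "\<dots> = w \<bullet> w" by (simp add: t_def)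
    finally have "t * (t * c) \<le> t * (w \<bullet> w)" using tpos by simp
    moreover have "0 < t * (w \<bullet> w)" using tpos pos by simp
    ultimately show False using q[of "- t"] by (simp add: power2_eq_square)
  qed
  then have "T v = \<mu> *\<^sub>R v" by (simp add: w_def)
  with that v le show thesis by blast
qed

section \<open>Hermitian inner product and adjoints\<close>

text \<open>Conjugate-linear in the first argument. The real inner product is only its real part,
  and orthogonality over the complex numbers needs the imaginary part too.\<close>

definition cinner :: "complex^'n \<Rightarrow> complex^'n \<Rightarrow> complex" where
  "cinner x y = (\<Sum>i\<in>UNIV. cnj (x $ i) * y $ i)"

lemma Re_cinner: "Re (cinner x y) = x \<bullet> y"
  by (simp add: cinner_def inner_vec_def inner_complex_def)

lemma cinner_commute: "cinner x y = cnj (cinner y x)"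
  by (simp add: cinner_def mult.commute)

lemma cinner_simps [simp]:
  "cinner x (y + z) = cinner x y + cinner x z" "cinner (x + y) z = cinner x z + cinner y z"
  "cinner x (y - z) = cinner x y - cinner x z" "cinner (x - y) z = cinner x z - cinner y z"
  "cinner x 0 = 0" "cinner 0 x = 0"
  "cinner x (c *s y) = c * cinner x y" "cinner (c *s x) y = cnj c * cinner x y"
  "cinner x (r *\<^sub>R y) = of_real r * cinner x y" "cinner (r *\<^sub>R x) y = of_real r * cinner x y"
  by (simp_all add: cinner_def sum.distrib sum_subtractf sum_distrib_left algebra_simps
      scaleR_conv_of_real[where 'a = complex])

lemma cinner_same: "cinner x x = of_real ((norm x)\<^sup>2)"
proof (rule complex_eqI)
  show "Re (cinner x x) = Re (of_real ((norm x)\<^sup>2))"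
    by (simp only: Re_cinner power2_norm_eq_inner Re_complex_of_real)
  have "cinner x x = cnj (cinner x x)" by (rule cinner_commute)
  then have "Im (cinner x x) = - Im (cinner x x)" by (metis cnj.sel(2))
  then show "Im (cinner x x) = Im (of_real ((norm x)\<^sup>2))"
    by simp
qed

lemma cinner_ctranspose: "cinner x (A *v y) = cinner (ctranspose A *v x) y"
proof -
  have "cinner x (A *v y) = (\<Sum>i\<in>UNIV. \<Sum>j\<in>UNIV. cnj (x $ i) * (A $ i $ j * y $ j))"
    by (simp add: cinner_def matrix_vector_mult_def sum_distrib_left)
  also have "\<dots> = (\<Sum>j\<in>UNIV. \<Sum>i\<in>UNIV. cnj (x $ i) * (A $ i $ j * y $ j))"
    by (rule sum.swap)
  also have "\<dots> = cinner (ctranspose A *v x) y"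
    by (simp add: cinner_def matrix_vector_mult_def ctranspose_def sum_distrib_right sum_distrib_left mult_ac)
  finally show ?thesis .
qed

lemma ctranspose_ctranspose [simp]: "ctranspose (ctranspose A) = A"
  by (simp add: ctranspose_def vec_eq_iff)

lemma ctranspose_mul: "ctranspose (A ** B) = ctranspose B ** ctranspose A"
  by (simp add: ctranspose_def matrix_matrix_mult_def vec_eq_iff mult.commute)

lemma inner_ctranspose: "x \<bullet> (A *v y) = (ctranspose A *v x) \<bullet> y"
  by (metis Re_cinner cinner_ctranspose)

lemma Hermitian_cinner: "Hermitian H \<Longrightarrow> cinner x (H *v y) = cinner (H *v x) y"
  by (simp add: cinner_ctranspose Hermitian_def)

lemma Hermitian_inner: "Hermitian H \<Longrightarrow> x \<bullet> (H *v y) = (H *v x) \<bullet> y"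
  by (simp add: inner_ctranspose Hermitian_def)

text \<open>Complex orthogonality to \<open>s\<close> is real orthogonality to both \<open>s\<close>
  and \<open>\<i> s\<close>. This makes at most \<open>2 * card S\<close> real conditions in a space
  of real dimension \<open>2 n\<close>.\<close>

lemma exists_cinner_orthogonal:
  fixes S :: "(complex^'n) set"
  assumes "finite S" "card S < CARD('n)"
  obtains x where "x \<noteq> 0" "\<And>s. s \<in> S \<Longrightarrow> cinner s x = 0"
proof -
  let ?T = "S \<union> (*s) \<i> ` S"
  have "dim ?T \<le> card ?T" using assms by (intro dim_le_card') auto
  also have "\<dots> \<le> card S + card S"
    using card_Un_le[of S "(*s) \<i> ` S"] card_image_le[OF assms(1), of "(*s) \<i>"] by linarith
  also have "\<dots> < DIM(complex^'n)" using assms by simp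
  finally obtain x where x: "x \<noteq> 0" "\<And>y. y \<in> span ?T \<Longrightarrow> orthogonal x y"
    using orthogonal_to_subspace_exists by blast
  have "cinner s x = 0" if "s \<in> S" for s
  proof -
    have "orthogonal x s" "orthogonal x (\<i> *s s)"
      using that by (auto intro!: x span_base)
    then have "cinner x s = 0"
      by (auto simp: orthogonal_def complex_eq_iff simp flip: Re_cinner)
    then show ?thesis by (metis cinner_commute complex_cnj_zero)
  qed
  with x that show thesis by blast
qed

section \<open>Orthonormal bases of eigenvectors\<close>

definition rayleigh :: "complex^'n^'n \<Rightarrow> complex^'n \<Rightarrow> real" where
  "rayleigh A x = x \<bullet> (A *v x)"

text \<open>Writing the eigenvalue of a unit eigenvector as its Rayleigh value makes it a function
  of the vector, so that eigenvalues can be collected as an image of the basis.\<close>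

definition eigen_orthonormal :: "complex^'n^'n \<Rightarrow> (complex^'n) set \<Rightarrow> bool" where
  "eigen_orthonormal A B \<longleftrightarrow> finite B \<and> (\<forall>x\<in>B. \<forall>y\<in>B. cinner x y = (if x = y then 1 else 0)) \<and>
     (\<forall>x\<in>B. A *v x = rayleigh A x *\<^sub>R x)"

lemma eigen_orthonormal_insert:
  assumes "eigen_orthonormal A B" "norm v = 1" "A *v v = \<mu> *\<^sub>R v" "\<And>b. b \<in> B \<Longrightarrow> cinner b v = 0"
  shows "eigen_orthonormal A (insert v B)" "v \<notin> B"
proof -
  have "rayleigh A v = \<mu>"
    using assms(2,3) by (simp add: rayleigh_def flip: power2_norm_eq_inner)
  moreover have "cinner v b = 0" if "b \<in> B" for b
    using assms(4)[OF that] by (metis cinner_commute complex_cnj_zero)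
  moreover have "cinner v v = 1" using assms(2) by (simp add: cinner_same)
  ultimately show "v \<notin> B" "eigen_orthonormal A (insert v B)"
    using assms by (auto simp: eigen_orthonormal_def)
qed

text \<open>The orthogonal complement of eigenvectors of a Hermitian matrix is invariant, and by
  counting dimensions it is nonzero while \<open>B\<close> is too small; so it contains a further
  eigenvector. Starting from a given \<open>B\<close> matters later, when the eigenvectors supplied
  by a frame have to be completed.\<close>

lemma eigen_orthonormal_extend:
  fixes A :: "complex^'n^'n"
  assumes "Hermitian A" "eigen_orthonormal A B" "card B \<le> CARD('n)"
  obtains C where "B \<subseteq> C" "eigen_orthonormal A C" "card C = CARD('n)"
  using assms
proof (induction "CARD('n) - card B" arbitrary: B thesis)
  case 0
  then show ?case by auto
next
  case (Suc m)
  let ?W = "{x. \<forall>b\<in>B. cinner b x = 0}"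
  have fin: "finite B" and eig: "\<And>b. b \<in> B \<Longrightarrow> A *v b = rayleigh A b *\<^sub>R b"
    using Suc.prems by (auto simp: eigen_orthonormal_def)
  have "card B < CARD('n)" using Suc.hyps(2) by linarith
  then obtain z where z: "z \<noteq> 0" "\<And>b. b \<in> B \<Longrightarrow> cinner b z = 0"
    using exists_cinner_orthogonal[OF fin] by metis
  obtain v \<mu> where v: "v \<in> ?W" "norm v = 1" "A *v v = \<mu> *\<^sub>R v"
  proof (rule selfadjoint_Min_eigenvector)
    show "linear ((*v) A)" by (rule matrix_vector_mul_linear)
    show "x \<bullet> (A *v y) = (A *v x) \<bullet> y" for x y by (rule Hermitian_inner[OF Suc.prems(2)])
    show "subspace ?W" by (auto simp: subspace_def)
    show "A *v x \<in> ?W" if "x \<in> ?W" for x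
      using that Suc.prems(2) by (auto simp: Hermitian_cinner eig)
    show "z \<in> ?W" "z \<noteq> 0" using z by auto
  qed
  have ins: "eigen_orthonormal A (insert v B)" "v \<notin> B"
    using v(1) eigen_orthonormal_insert[OF Suc.prems(3) v(2,3)] by blast+
  then have card: "card (insert v B) = Suc (card B)" using fin by simp
  obtain C where "insert v B \<subseteq> C" "eigen_orthonormal A C" "card C = CARD('n)"
  proof (rule Suc.hyps(1)[of "insert v B"])
    show "m = CARD('n) - card (insert v B)" "card (insert v B) \<le> CARD('n)"
      using card Suc.hyps(2) by linarith+
  qed (use ins Suc.prems in auto)
  then show ?case using Suc.prems(1)[of C] by blast
qed

lemma eigen_orthonormal_basis_exists:
  fixes A :: "complex^'n^'n"
  assumes "Hermitian A"
  obtains C where "eigen_orthonormal A C" "card C = CARD('n)"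
  using eigen_orthonormal_extend[OF assms, of "{}"] by (auto simp: eigen_orthonormal_def)

lemma columns_mult_vec:
  fixes e :: "'k::finite \<Rightarrow> complex^'n"
  shows "(\<chi> i j. e j $ i) *v x = (\<Sum>j\<in>UNIV. x $ j *s e j)"
  by (simp add: vec_eq_iff matrix_vector_mult_def mult.commute)

lemma ctranspose_columns_mult_vec: "(ctranspose (\<chi> i j. e j $ i) *v x) $ j = cinner (e j) x"
  by (simp add: ctranspose_def matrix_vector_mult_def cinner_def)

lemma columns_mult_axis [simp]: "(\<chi> i j. e j $ i) *v axis j 1 = e j"
  by (simp add: vec_eq_iff matrix_vector_mult_def axis_def if_distrib cong: if_cong)

lemma cinner_axis: "cinner (axis i 1) x = x $ i"
proof -
  have "cinner (axis i 1) x = (\<Sum>j\<in>UNIV. if j = i then x $ j else 0)"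
    unfolding cinner_def by (rule sum.cong) (auto simp: axis_def)
  then show ?thesis by simp
qed

lemma columns_in_Vk:
  assumes "\<And>i j. cinner (e i) (e j) = (if i = j then 1 else 0)"
  shows "(\<chi> i j. e j $ i) \<in> Vk"
proof -
  have "(ctranspose (\<chi> i j. e j $ i) ** (\<chi> i j. e j $ i)) $ i $ j = cinner (e i) (e j)" for i j
    by (simp add: ctranspose_def matrix_matrix_mult_def cinner_def)
  then show ?thesis using assms by (simp add: Vk_def vec_eq_iff mat_def)
qed

lemma eigen_basis_columns:
  fixes A :: "complex^'n^'n"
  assumes "eigen_orthonormal A C" "card C = CARD('n)"
  obtains e :: "'n \<Rightarrow> complex^'n" where "bij_betw e UNIV C"
    "(\<chi> i j. e j $ i) ** ctranspose (\<chi> i j. e j $ i) = mat 1"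
    "ctranspose (\<chi> i j. e j $ i) ** (\<chi> i j. e j $ i) = mat 1"
proof -
  obtain e :: "'n \<Rightarrow> complex^'n" where e: "bij_betw e UNIV C"
    using finite_same_card_bij[of "UNIV :: 'n set" C] assms by (auto simp: eigen_orthonormal_def)
  then have "e i \<in> C" for i by (auto simp: bij_betw_def)
  moreover have "e i = e j \<longleftrightarrow> i = j" for i j using e by (auto simp: bij_betw_def inj_def)
  ultimately have "(\<chi> i j. e j $ i) \<in> Vk"
    using assms by (intro columns_in_Vk) (auto simp: eigen_orthonormal_def)
  then have "ctranspose (\<chi> i j. e j $ i) ** (\<chi> i j. e j $ i) = mat 1" by (simp add: Vk_def)
  then show thesis using that[OF e] matrix_left_right_inverse by blast
qed

lemma eigen_basis_expansion:
  fixes A :: "complex^'n^'n"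
  assumes "eigen_orthonormal A C" "card C = CARD('n)"
  shows "x = (\<Sum>c\<in>C. cinner c x *s c)"
proof -
  obtain e :: "'n \<Rightarrow> complex^'n" where e: "bij_betw e UNIV C"
    and U: "(\<chi> i j. e j $ i) ** ctranspose (\<chi> i j. e j $ i) = mat 1"
    using eigen_basis_columns[OF assms] .
  have "x = (\<chi> i j. e j $ i) *v (ctranspose (\<chi> i j. e j $ i) *v x)"
    by (simp add: matrix_vector_mul_assoc U)
  also have "\<dots> = (\<Sum>j\<in>UNIV. cinner (e j) x *s e j)"
    by (simp only: columns_mult_vec ctranspose_columns_mult_vec)
  also have "\<dots> = (\<Sum>c\<in>C. cinner c x *s c)"
    by (rule sum.reindex_bij_betw[OF e])
  finally show ?thesis .
qed

lemma cinner_sum_right: "cinner x (\<Sum>i\<in>I. f i) = (\<Sum>i\<in>I. cinner x (f i))"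
  by (induction I rule: infinite_finite_induct) auto

lemma matrix_vector_mult_sum: "A *v (\<Sum>i\<in>I. f i) = (\<Sum>i\<in>I. A *v (f i :: complex^'n))"
  by (induction I rule: infinite_finite_induct) (auto simp: matrix_vector_right_distrib)

text \<open>Parseval's identity and its weighted form: expand one of the two arguments in the
  eigenbasis.\<close>

lemma
  fixes A :: "complex^'n^'n"
  assumes C: "eigen_orthonormal A C" "card C = CARD('n)"
  shows eigen_basis_norm: "(norm x)\<^sup>2 = (\<Sum>c\<in>C. (cmod (cinner c x))\<^sup>2)"
    and eigen_basis_inner: "x \<bullet> (A *v x) = (\<Sum>c\<in>C. rayleigh A c * (cmod (cinner c x))\<^sup>2)"
proof -
  have coef: "cinner c x * cinner x c = of_real ((cmod (cinner c x))\<^sup>2)" for c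
    by (subst cinner_commute[of x c]) (simp only: complex_norm_square)
  have "complex_of_real ((norm x)\<^sup>2) = cinner x x" by (rule cinner_same[symmetric])
  also have "\<dots> = cinner x (\<Sum>c\<in>C. cinner c x *s c)"
    by (rule arg_cong[OF eigen_basis_expansion[OF C]])
  also have "\<dots> = of_real (\<Sum>c\<in>C. (cmod (cinner c x))\<^sup>2)"
    by (simp add: cinner_sum_right coef del: of_real_power)
  finally show "(norm x)\<^sup>2 = (\<Sum>c\<in>C. (cmod (cinner c x))\<^sup>2)"
    by (simp only: of_real_eq_iff)
  have "cinner x (A *v x) = cinner x (A *v (\<Sum>c\<in>C. cinner c x *s c))"
    by (rule arg_cong[where f = "\<lambda>y. cinner x (A *v y)", OF eigen_basis_expansion[OF C]])
  also have "A *v (\<Sum>c\<in>C. cinner c x *s c) = (\<Sum>c\<in>C. cinner c x *s (rayleigh A c *\<^sub>R c))"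
    using C unfolding matrix_vector_mult_sum eigen_orthonormal_def
    by (intro sum.cong) (auto simp: vector_scalar_commute)
  also have "cinner x \<dots> = (\<Sum>c\<in>C. of_real (rayleigh A c) * (cinner c x * cinner x c))"
    by (simp add: cinner_sum_right algebra_simps)
  also have "\<dots> = of_real (\<Sum>c\<in>C. rayleigh A c * (cmod (cinner c x))\<^sup>2)"
    by (simp add: coef del: of_real_power)
  finally show "x \<bullet> (A *v x) = (\<Sum>c\<in>C. rayleigh A c * (cmod (cinner c x))\<^sup>2)"
    by (simp only: Re_complex_of_real flip: Re_cinner)
qed

text \<open>Eigenvectors orthogonal to \<open>x\<close> contribute nothing, so only the eigenvalues
  seen by \<open>x\<close> need the bound. This turns orthogonality conditions into bounds by a
  chosen eigenvalue, as in the Courant-Fischer principle.\<close>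

lemma eigen_basis_inner_le:
  fixes A :: "complex^'n^'n"
  assumes C: "eigen_orthonormal A C" "card C = CARD('n)"
    and le: "\<And>c. c \<in> C \<Longrightarrow> cinner c x \<noteq> 0 \<Longrightarrow> rayleigh A c \<le> a"
  shows "x \<bullet> (A *v x) \<le> a * (norm x)\<^sup>2"
  unfolding eigen_basis_norm[OF C] eigen_basis_inner[OF C] sum_distrib_left
proof (rule sum_mono)
  show "rayleigh A c * (cmod (cinner c x))\<^sup>2 \<le> a * (cmod (cinner c x))\<^sup>2" if "c \<in> C" for c
    using le[OF that] by (cases "cinner c x = 0") (auto intro: mult_right_mono)
qed

lemma eigen_basis_inner_ge:
  fixes A :: "complex^'n^'n"
  assumes C: "eigen_orthonormal A C" "card C = CARD('n)"
    and ge: "\<And>c. c \<in> C \<Longrightarrow> cinner c x \<noteq> 0 \<Longrightarrow> a \<le> rayleigh A c"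
  shows "a * (norm x)\<^sup>2 \<le> x \<bullet> (A *v x)"
  unfolding eigen_basis_norm[OF C] eigen_basis_inner[OF C] sum_distrib_left
proof (rule sum_mono)
  show "a * (cmod (cinner c x))\<^sup>2 \<le> rayleigh A c * (cmod (cinner c x))\<^sup>2" if "c \<in> C" for c
    using ge[OF that] by (cases "cinner c x = 0") (auto intro: mult_right_mono)
qed

section \<open>Roots of the characteristic polynomial and eigenbases\<close>

text \<open>Viewed as matrices of constant polynomials, \<open>A U = U D\<close> yields
  \<open>(X - A) U = U (X - D)\<close>. Taking determinants, the factor \<open>det U\<close> cancels
  because \<open>U W = 1\<close> makes it nonzero.\<close>

lemma charpol_conj:
  fixes U W A D :: "complex^'n^'n"
  assumes UW: "U ** W = mat 1" and AU: "A ** U = U ** D"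
  shows "charpol A = charpol D"
proof -
  define lift :: "complex^'n^'n \<Rightarrow> complex poly^'n^'n" where "lift M = (\<chi> i j. [:M $ i $ j:])" for M
  have sum_const: "(\<Sum>i\<in>I. [:f i:]) = [:\<Sum>i\<in>I. f i:]" for I :: "'n set" and f :: "'n \<Rightarrow> complex"
    by (induction I rule: infinite_finite_induct) auto
  have mul: "lift M ** lift N = lift (M ** N)" for M N
    by (simp add: lift_def matrix_matrix_mult_def sum_const mult.commute)
  have cp: "charpol M = det (mat [:0, 1:] - lift M)" for M
    unfolding charpol_def by (rule arg_cong[where f = det]) (simp add: vec_eq_iff mat_def lift_def)
  have "lift (mat 1) = mat 1" by (simp add: lift_def mat_def vec_eq_iff one_pCons)
  then have "det (lift U) * det (lift W) = 1"
    using UW mul[of U W] by (metis det_I det_mul)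
  then have nz: "det (lift U) \<noteq> 0" by auto
  have comm: "mat [:0, 1:] ** M = M ** mat [:0, 1 :: complex:]" for M :: "complex poly^'n^'n"
    by (simp add: vec_eq_iff matrix_matrix_mult_def mat_def if_distrib if_distribR mult.commute
        sum.delta sum.delta' cong: if_cong)
  have dist: "M ** (N - K) = M ** N - M ** K" "(N - K) ** M = N ** M - K ** M" for M N K :: "complex poly^'n^'n"
    by (simp_all add: vec_eq_iff matrix_matrix_mult_def sum_subtractf algebra_simps)
  have "(mat [:0, 1:] - lift A) ** lift U = lift U ** (mat [:0, 1:] - lift D)"
    by (simp add: dist comm mul AU)
  then have "charpol A * det (lift U) = det (lift U) * charpol D"
    unfolding cp by (metis det_mul)
  with nz show ?thesis by simp
qed

lemma charpol_diag: "charpol (\<chi> i j. if i = j then l j else 0) = (\<Prod>i\<in>UNIV. [:- l i, 1:])"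
  unfolding charpol_def by (subst det_diagonal) auto

text \<open>The unitary matrix with columns \<open>C\<close> diagonalises \<open>A\<close>, so the
  characteristic polynomial splits into linear factors with the Rayleigh values as roots. This links
  the eigenvalue list, defined through roots, to eigenvectors.\<close>

lemma mset_eigs:
  fixes A :: "complex^'n^'n"
  assumes C: "eigen_orthonormal A C" "card C = CARD('n)"
  shows "mset (eigs A) = image_mset (rayleigh A) (mset_set C)"
proof -
  obtain e :: "'n \<Rightarrow> complex^'n" where e: "bij_betw e UNIV C"
    and U: "(\<chi> i j. e j $ i) ** ctranspose (\<chi> i j. e j $ i) = mat 1"
    using eigen_basis_columns[OF assms] .
  define D :: "complex^'n^'n" where "D = (\<chi> i j. if i = j then of_real (rayleigh A (e j)) else 0)"
  have "e j \<in> C" for j using e by (auto simp: bij_betw_def)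
  then have ev: "A *v e j = rayleigh A (e j) *\<^sub>R e j" for j
    using C by (auto simp: eigen_orthonormal_def)
  have "(A ** (\<chi> i j. e j $ i)) $ i $ j = ((\<chi> i j. e j $ i) ** D) $ i $ j" for i j
  proof -
    have "(A ** (\<chi> i j. e j $ i)) $ i $ j = (A *v e j) $ i"
      by (simp add: matrix_matrix_mult_def matrix_vector_mult_def)
    also have "\<dots> = ((\<chi> i j. e j $ i) ** D) $ i $ j"
      by (simp add: ev D_def matrix_matrix_mult_def scaleR_conv_of_real[where 'a = complex]
          if_distrib mult.commute cong: if_cong)
    finally show ?thesis .
  qed
  then have "A ** (\<chi> i j. e j $ i) = (\<chi> i j. e j $ i) ** D" by (simp add: vec_eq_iff)
  from charpol_conj[OF U this] have "charpol A = (\<Prod>i\<in>UNIV. [:- of_real (rayleigh A (e i)), 1:])"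
    by (simp add: D_def charpol_diag)
  then have "proots (charpol A) = (\<Sum>i\<in>UNIV. {# of_real (rayleigh A (e i)) #})"
    by (simp add: proots_prod)
  also have "\<dots> = image_mset (\<lambda>i. of_real (rayleigh A (e i))) (mset_set UNIV)"
    by (simp add: sum_unfold_sum_mset)
  finally have "mset (eigs A) = image_mset (rayleigh A) (image_mset e (mset_set UNIV))"
    by (simp add: eigs_def multiset.map_comp comp_def)
  also have "image_mset e (mset_set UNIV) = mset_set C"
    using e by (metis bij_betw_def image_mset_mset_set)
  finally show ?thesis .
qed

lemma sorted_eigs: "sorted (eigs A)"
  by (simp add: eigs_def)

lemma eigen_basis_sorted:
  fixes A :: "complex^'n^'n"
  assumes C: "eigen_orthonormal A C" "card C = CARD('n)"
  obtains cs where "set cs = C" "distinct cs" "map (rayleigh A) cs = eigs A" "length cs = CARD('n)"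
proof -
  obtain bs where bs: "set bs = C" "distinct bs"
    using finite_distinct_list[of C] C by (auto simp: eigen_orthonormal_def)
  let ?cs = "sort_key (rayleigh A) bs"
  have "mset (map (rayleigh A) ?cs) = mset (eigs A)"
    using bs by (simp add: mset_eigs[OF C] flip: mset_set_set)
  then have "sort (eigs A) = map (rayleigh A) ?cs"
    by (intro properties_for_sort sorted_sort_key)
  then have "map (rayleigh A) ?cs = eigs A" by (simp add: sorted_sort_id sorted_eigs)
  moreover have "length ?cs = CARD('n)" using bs C distinct_card[of bs] by simp
  ultimately show thesis using bs that[of ?cs] by simp
qed

lemma length_eigs: "Hermitian A \<Longrightarrow> length (eigs A) = CARD('n)" for A :: "complex^'n^'n"
  by (metis eigen_basis_sorted eigen_orthonormal_basis_exists length_map)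

text \<open>Weyl's inequality; the indices of the lists start at 0.\<close>

lemma eigs_perturb_le:
  fixes A H :: "complex^'n^'n"
  assumes AH: "Hermitian A" "Hermitian H" and j: "j < CARD('n)"
    and le: "\<And>x. x \<bullet> (H *v x) \<le> x \<bullet> (A *v x) + r * (norm x)\<^sup>2"
  shows "eigs H ! j \<le> eigs A ! j + r"
proof -
  obtain B where B: "eigen_orthonormal A B" "card B = CARD('n)"
    using eigen_orthonormal_basis_exists[OF AH(1)] .
  obtain bs where bs: "set bs = B" "distinct bs" "map (rayleigh A) bs = eigs A" "length bs = CARD('n)"
    using eigen_basis_sorted[OF B] .
  obtain C where C: "eigen_orthonormal H C" "card C = CARD('n)"
    using eigen_orthonormal_basis_exists[OF AH(2)] .
  obtain cs where cs: "set cs = C" "distinct cs" "map (rayleigh H) cs = eigs H" "length cs = CARD('n)"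
    using eigen_basis_sorted[OF C] .
  \<comment> \<open>These are \<open>n - 1 - j\<close> eigenvectors of \<open>A\<close> and
    \<open>j\<close> of \<open>H\<close>, hence at most \<open>n - 1\<close> conditions. A nonzero
    \<open>x\<close> orthogonal to all of them sees only eigenvalues of \<open>A\<close> up to index
    \<open>j\<close> and eigenvalues of \<open>H\<close> from index \<open>j\<close> on.\<close>
  let ?S = "set (drop (Suc j) bs) \<union> set (take j cs)"
  have "card ?S \<le> length (drop (Suc j) bs) + length (take j cs)"
    by (rule order.trans[OF card_Un_le]) (intro add_mono card_length)
  also have "\<dots> < CARD('n)" using j bs cs by simp
  finally obtain x where x: "x \<noteq> 0" "\<And>s. s \<in> ?S \<Longrightarrow> cinner s x = 0"
    using exists_cinner_orthogonal[of ?S] by blast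
  have "eigs H ! j * (norm x)\<^sup>2 \<le> x \<bullet> (H *v x)"
  proof (rule eigen_basis_inner_ge[OF C])
    fix c assume "c \<in> C" and nz: "cinner c x \<noteq> 0"
    then obtain i where i: "i < length cs" "c = cs ! i" using cs by (metis in_set_conv_nth)
    then have "j \<le> i" using x(2)[of c] nz by (force simp: in_set_conv_nth)
    then show "eigs H ! j \<le> rayleigh H c"
      using i sorted_nth_mono[OF sorted_eigs[of H], of j i] by (simp flip: cs(3))
  qed
  also have "\<dots> \<le> x \<bullet> (A *v x) + r * (norm x)\<^sup>2" by (rule le)
  also have "x \<bullet> (A *v x) \<le> eigs A ! j * (norm x)\<^sup>2"
  proof (rule eigen_basis_inner_le[OF B])
    fix b assume "b \<in> B" and nz: "cinner b x \<noteq> 0"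
    then obtain i where i: "i < length bs" "b = bs ! i" using bs by (metis in_set_conv_nth)
    have "i \<le> j"
    proof (rule ccontr)
      assume "\<not> i \<le> j"
      then have "b \<in> set (drop (Suc j) bs)"
        using i by (auto simp: in_set_conv_nth intro!: exI[of _ "i - Suc j"])
      then show False using x(2)[of b] nz by simp
    qed
    then show "rayleigh A b \<le> eigs A ! j"
      using i j bs(4) sorted_nth_mono[OF sorted_eigs[of A], of i j] by (simp flip: bs(3))
  qed
  finally have "eigs H ! j * (norm x)\<^sup>2 \<le> (eigs A ! j + r) * (norm x)\<^sup>2"
    by (simp add: algebra_simps)
  then show ?thesis using x(1) by simp
qed

section \<open>Orthonormal frames and the Davis-Kahan theorem\<close>

lemma ctranspose_mult_vec_left_inverse [simp]: "V \<in> Vk \<Longrightarrow> ctranspose V *v (V *v y) = y"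
  by (simp add: Vk_def matrix_vector_mul_assoc)

lemma Vk_cinner [simp]: "V \<in> Vk \<Longrightarrow> cinner (V *v x) (V *v y) = cinner x y"
  by (simp add: cinner_ctranspose)

lemma Vk_norm [simp]: "V \<in> Vk \<Longrightarrow> norm (V *v y) = norm y"
  by (simp add: norm_eq_sqrt_inner inner_ctranspose)

lemma projmat_mult_vec: "projmat V *v x = V *v (ctranspose V *v x)"
  by (simp add: projmat_def matrix_vector_mul_assoc)

lemma Hermitian_projmat: "Hermitian (projmat V)"
  by (simp add: Hermitian_def projmat_def ctranspose_mul)

lemma projmat_mult_colspace [simp]: "V \<in> Vk \<Longrightarrow> projmat V *v (V *v y) = V *v y"
  by (simp add: projmat_mult_vec)

lemma ctranspose_projmat_complement: "V \<in> Vk \<Longrightarrow> ctranspose V *v (x - projmat V *v x) = 0"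
  by (simp add: projmat_mult_vec matrix_vector_mult_diff_distrib)

lemma projmat_pythagoras:
  assumes "V \<in> Vk"
  shows "(norm x)\<^sup>2 = (norm (projmat V *v x))\<^sup>2 + (norm (x - projmat V *v x))\<^sup>2"
proof -
  have "orthogonal (projmat V *v x) (x - projmat V *v x)"
    using ctranspose_projmat_complement[OF assms, of x]
    by (simp add: orthogonal_def projmat_mult_vec[of V x] inner_commute[of "V *v _"] inner_ctranspose)
  from norm_add_Pythagorean[OF this] show ?thesis by simp
qed

text \<open>Each projection fixes the range of the other, so \<open>P Q = Q\<close> and
  \<open>Q P = P\<close>; the adjoint of the first identity then gives \<open>Q = Q P = P\<close>.
  This removes the dependence on the basis chosen by \<open>onbasis\<close>.\<close>

lemma projmat_eq_if_colspace_eq: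
  fixes V X :: "complex^'k^'n"
  assumes "V \<in> Vk" "X \<in> Vk" "colspace X = colspace V"
  shows "projmat X = projmat V"
proof -
  have *: "projmat V ** projmat X = projmat X"
    if "V \<in> Vk" "X \<in> Vk" "colspace X = colspace V" for V X :: "complex^'k^'n"
  proof -
    have "projmat V *v (projmat X *v x) = projmat X *v x" for x
    proof -
      have "projmat X *v x \<in> colspace V"
        using that(3) by (auto simp: projmat_mult_vec colspace_def)
      then show ?thesis using that(1) by (auto simp: colspace_def)
    qed
    then show ?thesis by (simp add: matrix_eq flip: matrix_vector_mul_assoc)
  qed
  have "projmat X = ctranspose (projmat V ** projmat X)"
    using *[OF assms] Hermitian_projmat[of X] by (simp add: Hermitian_def)
  also have "\<dots> = projmat X ** projmat V"
    using Hermitian_projmat[of X] Hermitian_projmat[of V] by (simp add: Hermitian_def ctranspose_mul)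
  also have "\<dots> = projmat V" using *[of X V] assms by simp
  finally show ?thesis .
qed

section \<open>Frames belonging to the k smallest eigenvalues\<close>

text \<open>The solution condition with the matrix frozen: a solution of the nonlinear problem is a
  frame \<open>V\<close> that is lowest for the matrix it generates itself.\<close>

definition lowest_frame :: "complex^'n^'n \<Rightarrow> complex^'k^'n \<Rightarrow> bool" where
  "lowest_frame H V \<longleftrightarrow> V \<in> Vk \<and> H ** V = V ** (ctranspose V ** H ** V) \<and>
     eigs (ctranspose V ** H ** V) = take CARD('k) (eigs H)"

lemma NEPv_solution_iff: "NEPv_solution A V \<longleftrightarrow> lowest_frame (A (projmat V)) V"
  by (simp add: NEPv_solution_def lowest_frame_def Let_def)

lemma matrix_vector_mult_scaleR_complex:
  "A *v (r *\<^sub>R x) = r *\<^sub>R (A *v (x :: complex^'n))"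
  by (rule linear_scale[OF matrix_vector_mul_linear])

text \<open>Both bounds come from an eigenbasis of the compression \<open>L\<close>. Its eigenvalues
  are the \<open>k\<close> smallest ones of \<open>H\<close>, which gives the upper bound. Its image
  under \<open>V\<close> consists of eigenvectors of \<open>H\<close> and extends to an eigenbasis;
  a vector orthogonal to the columns of \<open>V\<close> has components only along the added
  vectors, which carry the remaining eigenvalues.\<close>

lemma
  fixes H :: "complex^'n^'n" and V :: "complex^'k^'n"
  assumes H: "Hermitian H" and kn: "CARD('k) < CARD('n)" and V: "lowest_frame H V"
  shows lowest_frame_upper: "(V *v y) \<bullet> (H *v (V *v y)) \<le> eig H CARD('k) * (norm y)\<^sup>2"
    and lowest_frame_lower:
      "ctranspose V *v x = 0 \<Longrightarrow> eig H (CARD('k) + 1) * (norm x)\<^sup>2 \<le> x \<bullet> (H *v x)"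
proof -
  define L where "L = ctranspose V ** H ** V"
  have Vk: "V \<in> Vk" and HV: "H ** V = V ** L" and eL: "eigs L = take CARD('k) (eigs H)"
    using V by (simp_all add: lowest_frame_def L_def)
  have L: "Hermitian L"
    using H by (simp add: Hermitian_def L_def ctranspose_mul matrix_mul_assoc)
  have HVv: "H *v (V *v z) = V *v (L *v z)" for z
    by (simp add: matrix_vector_mul_assoc HV)
  have inner: "(V *v z) \<bullet> (H *v (V *v z)) = z \<bullet> (L *v z)" for z
    using Vk by (simp add: HVv flip: Re_cinner)
  obtain D where D: "eigen_orthonormal L D" "card D = CARD('k)"
    using eigen_orthonormal_basis_exists[OF L] .
  have len: "length (eigs H) = CARD('n)" by (rule length_eigs[OF H])
  show "(V *v y) \<bullet> (H *v (V *v y)) \<le> eig H CARD('k) * (norm y)\<^sup>2"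
    unfolding inner
  proof (rule eigen_basis_inner_le[OF D])
    fix c assume "c \<in> D"
    then have "rayleigh L c \<in> set_mset (mset (eigs L))"
      using D(1) unfolding mset_eigs[OF D] by (auto simp: eigen_orthonormal_def)
    then have "rayleigh L c \<in> set (take CARD('k) (eigs H))" by (simp add: eL)
    then obtain i where i: "i < CARD('k)" "rayleigh L c = eigs H ! i"
      using kn len by (auto simp: in_set_conv_nth)
    then show "rayleigh L c \<le> eig H CARD('k)"
      using sorted_nth_mono[OF sorted_eigs[of H], of i "CARD('k) - 1"] kn len by (simp add: eig_def)
  qed
  let ?B = "(*v) V ` D"
  have inj: "inj_on ((*v) V) D"
    by (rule inj_on_inverseI[where g = "(*v) (ctranspose V)"]) (simp add: Vk)
  have ray: "rayleigh H (V *v d) = rayleigh L d" for d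
    by (simp add: rayleigh_def inner)
  have B: "eigen_orthonormal H ?B"
    unfolding eigen_orthonormal_def
  proof (intro conjI ballI)
    show "finite ?B" using D(1) by (simp add: eigen_orthonormal_def)
    show "cinner x y = (if x = y then 1 else 0)" if "x \<in> ?B" "y \<in> ?B" for x y
      using that D(1) Vk inj by (auto simp: eigen_orthonormal_def inj_on_eq_iff)
    show "H *v x = rayleigh H x *\<^sub>R x" if x: "x \<in> ?B" for x
    proof -
      obtain d where d: "d \<in> D" "x = V *v d" using x by blast
      then have "L *v d = rayleigh L d *\<^sub>R d" using D(1) by (simp add: eigen_orthonormal_def)
      then show ?thesis by (simp add: d(2) ray HVv matrix_vector_mult_scaleR_complex)
    qed
  qed
  have "card ?B \<le> CARD('n)" using inj D kn by (simp add: card_image)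
  from eigen_orthonormal_extend[OF H B this]
  obtain C where BC: "?B \<subseteq> C" and C: "eigen_orthonormal H C" "card C = CARD('n)" .
  have fin: "finite C" "finite ?B"
    using C(1) D(1) by (auto simp: eigen_orthonormal_def)
  have "image_mset (rayleigh H) (mset_set ?B) = image_mset (rayleigh L) (mset_set D)"
    by (simp add: image_mset_mset_set[OF inj, symmetric] multiset.map_comp comp_def ray)
  also have "\<dots> = mset (take CARD('k) (eigs H))"
    by (simp add: mset_eigs[OF D, symmetric] eL)
  finally have mB: "image_mset (rayleigh H) (mset_set ?B) = mset (take CARD('k) (eigs H))" .
  \<comment> \<open>Cancelling multisets leaves exactly the tail of the sorted list, also when
    eigenvalues are repeated.\<close>
  have "mset (eigs H) = image_mset (rayleigh H) (mset_set (?B \<union> (C - ?B)))"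
    using BC by (simp add: mset_eigs[OF C] Un_absorb1)
  also have "\<dots> = mset (take CARD('k) (eigs H)) + image_mset (rayleigh H) (mset_set (C - ?B))"
    using fin by (subst mset_set_Union) (auto simp: mB)
  finally have mC: "image_mset (rayleigh H) (mset_set (C - ?B)) = mset (drop CARD('k) (eigs H))"
    by (subst (asm) append_take_drop_id[of "CARD('k)" "eigs H", symmetric], subst (asm) mset_append) simp
  assume x: "ctranspose V *v x = 0"
  show "eig H (CARD('k) + 1) * (norm x)\<^sup>2 \<le> x \<bullet> (H *v x)"
  proof (rule eigen_basis_inner_ge[OF C])
    fix c assume c: "c \<in> C" "cinner c x \<noteq> 0"
    have "cinner (V *v d) x = 0" for d
      using cinner_ctranspose[of d "ctranspose V" x] x by simp
    then have "c \<in> C - ?B" using c by auto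
    then have "rayleigh H c \<in> set_mset (image_mset (rayleigh H) (mset_set (C - ?B)))"
      using fin by simp
    then have "rayleigh H c \<in> set (drop CARD('k) (eigs H))" unfolding mC by simp
    then obtain i where "i < CARD('n) - CARD('k)" "rayleigh H c = eigs H ! (CARD('k) + i)"
      using kn len by (auto simp: in_set_conv_nth)
    then show "eig H (CARD('k) + 1) \<le> rayleigh H c"
      using sorted_nth_mono[OF sorted_eigs[of H], of "CARD('k)" "CARD('k) + i"] kn len
      by (simp add: eig_def)
  qed
qed

lemma matrix_vector_mult_axis: "M *v axis j 1 = (\<chi> i. M $ i $ j)" for M :: "complex^'k^'n"
  by (simp add: vec_eq_iff matrix_vector_mult_def axis_def if_distrib cong: if_cong)

text \<open>Take the first \<open>k\<close> vectors of an eigenbasis sorted by eigenvalue as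
  columns. The compression is then diagonal, with the coordinate axes as its eigenbasis.\<close>

lemma lowest_frame_exists:
  fixes H :: "complex^'n^'n"
  assumes H: "Hermitian H" and kn: "CARD('k) < CARD('n)"
  obtains V :: "complex^'k^'n" where "lowest_frame H V"
proof -
  obtain C where C: "eigen_orthonormal H C" "card C = CARD('n)"
    using eigen_orthonormal_basis_exists[OF H] .
  obtain cs where cs: "set cs = C" "distinct cs" "map (rayleigh H) cs = eigs H" "length cs = CARD('n)"
    using eigen_basis_sorted[OF C] .
  define n where "n = (to_nat_on UNIV :: 'k \<Rightarrow> nat)"
  have n: "bij_betw n UNIV {..<CARD('k)}" unfolding n_def by (rule to_nat_on_finite) simp
  then have lt: "n j < CARD('n)" for j
    using kn bij_betwE[OF n] by (metis UNIV_I lessThan_iff order.strict_trans)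
  define e where "e j = cs ! n j" for j
  define l where "l j = eigs H ! n j" for j
  have eC: "e j \<in> C" for j using lt cs by (auto simp: e_def)
  have He: "H *v e j = l j *\<^sub>R e j" for j
  proof -
    have "rayleigh H (e j) = l j" using lt[of j] cs(4) by (simp add: e_def l_def flip: cs(3))
    then show ?thesis using C(1) eC[of j] by (auto simp: eigen_orthonormal_def)
  qed
  have "e i = e j \<longleftrightarrow> i = j" for i j
    using n lt cs by (auto simp: e_def nth_eq_iff_index_eq bij_betw_def inj_def)
  then have on: "cinner (e i) (e j) = (if i = j then 1 else 0)" for i j
    using C(1) eC[of i] eC[of j] by (simp add: eigen_orthonormal_def)
  define V :: "complex^'k^'n" where "V = (\<chi> i j. e j $ i)"
  have V: "V \<in> Vk" unfolding V_def by (rule columns_in_Vk) (rule on)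
  have Va: "V *v axis j 1 = e j" for j by (simp add: V_def)
  define L where "L = ctranspose V ** H ** V"
  have La: "L *v axis j 1 = l j *\<^sub>R axis j 1" for j
    unfolding L_def matrix_vector_mul_assoc[symmetric] Va He matrix_vector_mult_scaleR_complex
    unfolding Va[symmetric] by (simp only: ctranspose_mult_vec_left_inverse[OF V])
  have "(H ** V) *v axis j 1 = (V ** L) *v axis j 1" for j
    unfolding matrix_vector_mul_assoc[symmetric] Va He La matrix_vector_mult_scaleR_complex ..
  then have HV: "H ** V = V ** L" unfolding matrix_vector_mult_axis by (simp add: vec_eq_iff)
  let ?D = "range (\<lambda>j :: 'k. axis j (1 :: complex))"
  have inj: "inj (\<lambda>j :: 'k. axis j (1 :: complex))" by (auto simp: inj_def axis_eq_axis)
  have ray: "rayleigh L (axis j 1) = l j" for j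
    by (simp add: rayleigh_def La inner_axis_axis)
  have "cinner (axis i 1) (axis j 1) = (if axis i (1 :: complex) = axis j 1 then 1 else 0)" for i j :: 'k
    by (simp add: cinner_axis axis_eq_axis) (simp add: axis_def)
  then have D: "eigen_orthonormal L ?D" "card ?D = CARD('k)"
    unfolding eigen_orthonormal_def by (auto simp: La ray card_image[OF inj])
  have "mset (eigs L) = image_mset (rayleigh L) (image_mset (\<lambda>j. axis j 1) (mset_set UNIV))"
    unfolding mset_eigs[OF D] by (simp add: image_mset_mset_set[OF inj])
  also have "\<dots> = image_mset ((!) (eigs H)) (image_mset n (mset_set UNIV))"
    by (simp add: multiset.map_comp comp_def ray l_def)
  also have "image_mset n (mset_set UNIV) = mset_set {..<CARD('k)}"
    using n by (simp add: bij_betw_def image_mset_mset_set)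
  also have "\<dots> = mset [0..<CARD('k)]" by (simp add: lessThan_atLeast0)
  also have "image_mset ((!) (eigs H)) \<dots> = mset (map ((!) (eigs H)) [0..<CARD('k)])"
    by (simp only: mset_map)
  also have "map ((!) (eigs H)) [0..<CARD('k)] = take CARD('k) (eigs H)"
    using kn length_eigs[OF H] by (intro nth_equalityI) auto
  finally have "sort (take CARD('k) (eigs H)) = eigs L"
    by (rule properties_for_sort) (rule sorted_eigs)
  moreover have "sort (take CARD('k) (eigs H)) = take CARD('k) (eigs H)"
    by (intro sorted_sort_id sorted_wrt_take sorted_eigs)
  ultimately have "lowest_frame H V" using V HV by (simp add: lowest_frame_def L_def)
  then show thesis by (rule that)
qed

text \<open>The one-sided \<open>sin \<Theta>\<close> theorem of Davis and Kahan.  It suffices to bound the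
  largest singular value of the map \<open>y \<mapsto> (1 - V V\<^sup>H) W y\<close>; for a
  right singular vector \<open>y\<close> with left singular vector \<open>u\<close>, the pairing
  \<open>u \<bullet> (A - H) W y\<close> sees the gap times the squared singular value.\<close>

lemma davis_kahan:
  fixes A H :: "complex^'n^'n" and V W :: "complex^'k^'n"
  assumes V: "V \<in> Vk" "A ** V = V ** L" "\<And>x. ctranspose V *v x = 0 \<Longrightarrow> b * (norm x)\<^sup>2 \<le> x \<bullet> (A *v x)"
    and W: "W \<in> Vk" "H ** W = W ** M" "\<And>y. (W *v y) \<bullet> (H *v (W *v y)) \<le> a * (norm y)\<^sup>2"
    and r: "\<And>x. norm ((H - A) *v x) \<le> r * norm x" and ab: "a \<le> b"
  shows "(b - a) * norm (W *v y - projmat V *v (W *v y)) \<le> r * norm y"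
proof -
  define E where "E z = W *v z - projmat V *v (W *v z)" for z
  \<comment> \<open>With \<open>E = (1 - V V^H) W\<close>, this is minus the composition of the
    adjoint of \<open>E\<close> with \<open>E\<close>. The sign makes a minimal eigenvector of
    \<open>T\<close> a right singular vector for the largest singular value \<open>s\<close> of
    \<open>E\<close>.\<close>
  define T where "T z = - (ctranspose W *v E z)" for z
  have E: "E (x + z) = E x + E z" "E (c *\<^sub>R x) = c *\<^sub>R E x" for x z c
    by (simp_all add: E_def matrix_vector_right_distrib matrix_vector_mult_scaleR_complex scaleR_diff_right)
  have VE: "ctranspose V *v E z = 0" for z
    unfolding E_def by (rule ctranspose_projmat_complement[OF V(1)])
  have ort: "E z \<bullet> (V *v x) = 0" for z x by (simp add: inner_ctranspose VE)
  have ET: "x \<bullet> T z = - (E x \<bullet> E z)" for x z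
  proof -
    have "(W *v x) \<bullet> E z = E x \<bullet> E z + (projmat V *v (W *v x)) \<bullet> E z"
      by (simp add: E_def inner_diff_left)
    also have "(projmat V *v (W *v x)) \<bullet> E z = 0"
      unfolding projmat_mult_vec by (metis inner_commute ort)
    finally show ?thesis unfolding T_def by (simp add: inner_ctranspose)
  qed
  have lin: "linear T"
    by (rule linearI)
      (simp_all add: T_def E matrix_vector_right_distrib matrix_vector_mult_scaleR_complex)
  have sym: "x \<bullet> T z = T x \<bullet> z" for x z
    using ET[of x z] ET[of z x] by (simp only: inner_commute)
  have nz: "axis undefined 1 \<noteq> (0 :: complex^'k)" by (simp add: axis_eq_0_iff)
  obtain w \<mu> where w: "norm w = 1" "T w = \<mu> *\<^sub>R w"
    and min: "\<And>x. \<mu> * (norm x)\<^sup>2 \<le> x \<bullet> T x"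
    using selfadjoint_Min_eigenvector[OF lin sym subspace_UNIV UNIV_I UNIV_I nz]
    by (metis UNIV_I)
  define s where "s = norm (E w)"
  have \<mu>: "\<mu> = - s\<^sup>2"
  proof -
    have "\<mu> = w \<bullet> T w" using w by (simp flip: power2_norm_eq_inner)
    then show ?thesis by (simp add: ET s_def power2_norm_eq_inner)
  qed
  \<comment> \<open>Since the range of \<open>H W\<close> lies in that of \<open>W\<close>, this
    identity reduces the pairing of \<open>E w\<close> with \<open>H W w\<close> to
    \<open>s\<^sup>2\<close> times the form of \<open>H\<close> at \<open>W w\<close>.\<close>
  have Wu: "ctranspose W *v E w = s\<^sup>2 *\<^sub>R w"
    using w(2) unfolding T_def \<mu> by simp
  have "E w \<bullet> (H *v (W *v w)) = E w \<bullet> (W *v (M *v w))"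
    by (simp add: matrix_vector_mul_assoc W(2))
  also have "\<dots> = s\<^sup>2 * (w \<bullet> (M *v w))" by (simp add: inner_ctranspose[of "E w"] Wu)
  also have "w \<bullet> (M *v w) = (W *v w) \<bullet> (W *v (M *v w))"
    using W(1) by (simp add: inner_ctranspose)
  also have "\<dots> = (W *v w) \<bullet> (H *v (W *v w))" by (simp add: matrix_vector_mul_assoc W(2))
  also have "s\<^sup>2 * \<dots> \<le> s\<^sup>2 * a" using W(3)[of w] w(1) by (intro mult_left_mono) auto
  finally have 1: "E w \<bullet> (H *v (W *v w)) \<le> s\<^sup>2 * a" .
  have dec: "W *v w = E w + V *v (ctranspose V *v (W *v w))" by (simp add: E_def projmat_mult_vec)
  have "A *v (W *v w) = A *v E w + (A ** V) *v (ctranspose V *v (W *v w))"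
    by (subst dec) (simp only: matrix_vector_right_distrib matrix_vector_mul_assoc matrix_mul_assoc)
  then have "E w \<bullet> (A *v (W *v w)) = E w \<bullet> (A *v E w) + E w \<bullet> ((A ** V) *v (ctranspose V *v (W *v w)))"
    by (simp only: inner_add_right)
  \<comment> \<open>The range of \<open>A V = V L\<close> is orthogonal to \<open>E w\<close>, so
    only the component \<open>E w\<close> of \<open>W w\<close> contributes.\<close>
  also have "\<dots> = E w \<bullet> (A *v E w)"
    by (simp add: V(2) ort flip: matrix_vector_mul_assoc)
  finally have 2: "b * s\<^sup>2 \<le> E w \<bullet> (A *v (W *v w))"
    using V(3)[OF VE[of w]] by (simp add: s_def)
  have "(b - a) * s\<^sup>2 \<le> - (E w \<bullet> ((H - A) *v (W *v w)))"
    using 1 2 by (simp add: algebra_simps)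
  also have "\<dots> \<le> s * norm ((H - A) *v (W *v w))"
    unfolding s_def using Cauchy_Schwarz_ineq2[of "E w" "(H - A) *v (W *v w)"] by linarith
  also have "\<dots> \<le> s * r" using r[of "W *v w"] W(1) w(1) by (intro mult_left_mono) (auto simp: s_def)
  finally have "s * ((b - a) * s) \<le> s * r" by (simp add: power2_eq_square mult_ac)
  moreover have "0 \<le> r" using order_trans[OF norm_ge_zero r[of "W *v w"]] W(1) w(1) by simp
  moreover have "0 \<le> s" by (simp add: s_def)
  \<comment> \<open>One factor \<open>s\<close> is cancelled; for \<open>s = 0\<close> the claim is
    just \<open>0 \<le> r\<close>.\<close>
  ultimately have bs: "(b - a) * s \<le> r" by (cases "s = 0") auto
  have "(norm (E y))\<^sup>2 \<le> (s * norm y)\<^sup>2"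
    using min[of y] by (simp add: ET \<mu> power2_norm_eq_inner power_mult_distrib)
  then have "norm (E y) \<le> s * norm y"
    by (rule power2_le_imp_le) (simp add: s_def)
  then have "(b - a) * norm (E y) \<le> (b - a) * (s * norm y)" using ab by (intro mult_left_mono) auto
  also have "\<dots> \<le> r * norm y" using bs by (simp add: mult_right_mono flip: mult.assoc)
  finally show ?thesis by (simp add: E_def)
qed

text \<open>With \<open>P\<close>, \<open>Q\<close> the projections of \<open>V\<close>,
  \<open>W\<close> and \<open>z = x - P x\<close>, one has
  \<open>(Q - P) x = Q z - (1 - Q) P x\<close>, a sum of orthogonal vectors. Their norms are at most
  \<open>t\<close> times those of \<open>z\<close> and \<open>P x\<close>: for \<open>Q z\<close>,
  pair with \<open>z\<close> and use that \<open>z\<close> is orthogonal to the range of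
  \<open>P\<close>. Pythagoras, used twice, keeps the constant \<open>t\<close> without a
  factor.\<close>

lemma projmat_diff_le:
  fixes V W :: "complex^'k^'n"
  assumes V: "V \<in> Vk" and W: "W \<in> Vk" and t: "0 \<le> t"
    and VW: "\<And>y. norm (V *v y - projmat W *v (V *v y)) \<le> t * norm y"
    and WV: "\<And>y. norm (W *v y - projmat V *v (W *v y)) \<le> t * norm y"
  shows "norm ((projmat W - projmat V) *v x) \<le> t * norm x"
proof -
  define z where "z = x - projmat V *v x"
  define p where "p = ctranspose V *v x"
  define q where "q = ctranspose W *v z"
  have Px: "projmat V *v x = V *v p" by (simp add: p_def projmat_mult_vec)
  have eq: "(projmat W - projmat V) *v x = W *v q - (V *v p - projmat W *v (V *v p))"
    unfolding q_def z_def Px projmat_mult_vec[symmetric]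
    by (simp add: matrix_vector_mult_diff_rdistrib matrix_vector_mult_diff_distrib Px)
  have "(W *v q) \<bullet> (V *v p - projmat W *v (V *v p)) = 0"
    unfolding inner_commute[of "W *v q"] inner_ctranspose ctranspose_projmat_complement[OF W] by simp
  then have "orthogonal (W *v q) (- (V *v p - projmat W *v (V *v p)))"
    by (simp only: orthogonal_def inner_minus_right minus_zero)
  from norm_add_Pythagorean[OF this, folded diff_conv_add_uminus]
  have sum: "(norm ((projmat W - projmat V) *v x))\<^sup>2 = (norm q)\<^sup>2 + (norm (V *v p - projmat W *v (V *v p)))\<^sup>2"
    unfolding eq using W by (simp add: norm_minus_commute[of "projmat W *v (V *v p)"])
  have "(norm q)\<^sup>2 = z \<bullet> (W *v q)"
    by (simp add: q_def inner_ctranspose power2_norm_eq_inner)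
  also have "\<dots> = z \<bullet> (W *v q - projmat V *v (W *v q))"
    using ctranspose_projmat_complement[OF V, of x]
    by (simp add: inner_diff_right projmat_mult_vec[of V "W *v q"] inner_ctranspose[of _ V] flip: z_def)
  also have "\<dots> \<le> norm z * (t * norm q)"
    by (rule order_trans[OF norm_cauchy_schwarz mult_left_mono[OF WV]]) simp
  finally have "norm q * norm q \<le> norm q * (t * norm z)" by (simp add: power2_eq_square mult_ac)
  then have "norm q \<le> t * norm z" using t by (cases "q = 0") auto
  then have q: "(norm q)\<^sup>2 \<le> t\<^sup>2 * (norm z)\<^sup>2"
    unfolding power_mult_distrib[symmetric] by (intro power_mono) auto
  have "(norm (V *v p - projmat W *v (V *v p)))\<^sup>2 \<le> t\<^sup>2 * (norm (projmat V *v x))\<^sup>2"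
    unfolding power_mult_distrib[symmetric] Px using VW[of p] V by (intro power_mono) auto
  with sum q have "(norm ((projmat W - projmat V) *v x))\<^sup>2 \<le> t\<^sup>2 * ((norm (projmat V *v x))\<^sup>2 + (norm z)\<^sup>2)"
    by (simp add: distrib_left)
  also have "\<dots> = (t * norm x)\<^sup>2"
    unfolding z_def projmat_pythagoras[OF V, symmetric] power_mult_distrib ..
  finally show ?thesis by (rule power2_le_imp_le) (simp add: t)
qed

section \<open>Canonical angles\<close>

lemma norm2_bound: "norm (A *v x) \<le> norm2 A * norm x" for A :: "complex^'m^'n"
  unfolding norm2_def by (intro onorm matrix_vector_mul_bounded_linear)

lemma norm2_le:
  fixes A :: "'a::{euclidean_space,real_normed_algebra_1}^'m^'n"
  assumes "\<And>x. norm (A *v x) \<le> t * norm x"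
  shows "norm2 A \<le> t"
  unfolding norm2_def using assms by (rule onorm_le)

lemma norm2_nonneg: "0 \<le> norm2 A" for A :: "complex^'m^'n"
  unfolding norm2_def by (intro onorm_pos_le matrix_vector_mul_bounded_linear)

lemma norm2_pos: "A \<noteq> 0 \<Longrightarrow> 0 < norm2 A" for A :: "complex^'m^'n"
proof -
  assume "A \<noteq> 0"
  then obtain x where x: "A *v x \<noteq> 0 *v x" unfolding matrix_eq by blast
  have "norm2 A \<noteq> 0"
  proof
    assume "norm2 A = 0"
    then show False using norm2_bound[of A x] x by simp
  qed
  then show ?thesis using norm2_nonneg[of A] by simp
qed

text \<open>A crude comparison of the Frobenius norm with the 2-norm. It serves compactness and
  continuity only, where the size of the constant is irrelevant.\<close>

lemma norm_le_card_bound: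
  fixes A :: "complex^'m^'n"
  assumes "\<And>x. norm (A *v x) \<le> t * norm x"
  shows "norm A \<le> of_nat (CARD('n) * CARD('m)) * t"
proof -
  have entry: "norm (A $ i $ j) \<le> t" for i j
  proof -
    have "norm (A $ i $ j) \<le> norm (A *v axis j 1)"
      using Finite_Cartesian_Product.norm_nth_le[of "A *v axis j 1" i]
      by (simp add: matrix_vector_mult_axis)
    also have "\<dots> \<le> t" using assms[of "axis j 1"] by simp
    finally show ?thesis .
  qed
  have "norm A \<le> (\<Sum>i\<in>UNIV. norm (A $ i))" by (simp add: norm_vec_def L2_set_le_sum)
  also have "\<dots> \<le> (\<Sum>i\<in>UNIV. \<Sum>j\<in>UNIV. norm (A $ i $ j))"
    by (intro sum_mono) (simp add: norm_vec_def L2_set_le_sum)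
  also have "\<dots> \<le> (\<Sum>i\<in>(UNIV :: 'n set). \<Sum>j\<in>(UNIV :: 'm set). t)"
    by (intro sum_mono entry)
  finally show ?thesis by (simp add: algebra_simps)
qed

lemma Vk_onbasis:
  fixes V :: "complex^'k^'n"
  assumes "V \<in> Vk"
  shows "(onbasis (colspace V) :: complex^'k^'n) \<in> Vk"
    and "colspace (onbasis (colspace V) :: complex^'k^'n) = colspace V"
proof -
  have "(onbasis (colspace V) :: complex^'k^'n) \<in> Vk \<and>
      colspace (onbasis (colspace V) :: complex^'k^'n) = colspace V"
    unfolding onbasis_def by (rule someI[of _ V]) (simp add: assms)
  then show "(onbasis (colspace V) :: complex^'k^'n) \<in> Vk"
    and "colspace (onbasis (colspace V) :: complex^'k^'n) = colspace V" by auto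
qed

lemma norm2_diag_of_list_le:
  assumes len: "length xs = CARD('k)" and le: "\<And>x. x \<in> set xs \<Longrightarrow> \<bar>x\<bar> \<le> t"
  shows "norm2 (diag_of_list xs :: real^'k^'k) \<le> t"
proof (rule norm2_le)
  fix x :: "real^'k"
  let ?d = "\<lambda>i :: 'k. xs ! to_nat_on UNIV i"
  have "to_nat_on UNIV i < CARD('k)" for i :: 'k
    using bij_betwE[OF to_nat_on_finite[of "UNIV :: 'k set"]] by simp
  then have d: "\<bar>?d i\<bar> \<le> t" for i using le len by simp
  then have t: "0 \<le> t" using abs_ge_zero order_trans by blast
  have "((diag_of_list xs :: real^'k^'k) *v x) $ i = ?d i * x $ i" for i
    by (simp add: diag_of_list_def matrix_vector_mult_def if_distrib if_distribR cong: if_cong)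
  moreover have "\<bar>?d i * x $ i\<bar> \<le> \<bar>(t *\<^sub>R x) $ i\<bar>" for i
    using d[of i] t by (simp add: abs_mult mult_right_mono)
  ultimately have "norm ((diag_of_list xs :: real^'k^'k) *v x) \<le> norm (t *\<^sub>R x)"
    by (intro norm_le_componentwise_cart) simp
  then show "norm ((diag_of_list xs :: real^'k^'k) *v x) \<le> t * norm x" using t by simp
qed

text \<open>The squared cosines of the canonical angles are the values \<open>\<lambda> = (norm (P Y b))\<^sup>2\<close>
  at orthonormal eigenvectors \<open>b\<close> of \<open>Y\<^sup>H P Y\<close>, where \<open>P\<close> is the projection onto the column
  space of \<open>V\<close>.\<close>

lemma norm2_sin_Theta_le:
  fixes V W :: "complex^'k^'n"
  assumes V: "V \<in> Vk" and W: "W \<in> Vk"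
    and le: "\<And>y. norm (W *v y - projmat V *v (W *v y)) \<le> t * norm y"
  shows "norm2 (sin_Theta (colspace V) (colspace W) :: real^'k^'k) \<le> t"
proof -
  define X Y where "X = (onbasis (colspace V) :: complex^'k^'n)" and "Y = (onbasis (colspace W) :: complex^'k^'n)"
  have X: "X \<in> Vk" "projmat X = projmat V"
    using Vk_onbasis[OF V] projmat_eq_if_colspace_eq[OF V] by (auto simp: X_def)
  have Y: "Y \<in> Vk" "colspace Y = colspace W"
    using Vk_onbasis[OF W] by (auto simp: Y_def)
  define N where "N = ctranspose (ctranspose X ** Y) ** (ctranspose X ** Y)"
  have N: "Hermitian N" by (simp add: Hermitian_def N_def ctranspose_mul)
  have inner: "y \<bullet> (N *v y) = (norm (projmat V *v (Y *v y)))\<^sup>2" for y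
  proof -
    have "y \<bullet> (N *v y) = (norm (ctranspose X *v (Y *v y)))\<^sup>2"
      unfolding N_def matrix_vector_mul_assoc[symmetric] inner_ctranspose power2_norm_eq_inner
      by (simp add: matrix_vector_mul_assoc matrix_mul_assoc)
    also have "\<dots> = (norm (projmat X *v (Y *v y)))\<^sup>2"
      by (simp only: projmat_mult_vec Vk_norm[OF X(1)])
    finally show ?thesis using X by simp
  qed
  obtain D where D: "eigen_orthonormal N D" "card D = CARD('k)"
    using eigen_orthonormal_basis_exists[OF N] .
  have bound: "0 \<le> l \<and> sqrt (1 - l) \<le> t \<and> l \<le> 1" if "l \<in> set (eigs N)" for l
  proof -
    have "l \<in> set_mset (mset (eigs N))" using that by simp
    then obtain b where b: "b \<in> D" "l = rayleigh N b"
      using D(1) unfolding mset_eigs[OF D] by (auto simp: eigen_orthonormal_def)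
    have "(norm b)\<^sup>2 = 1"
      using b(1) D(1) cinner_same[of b] unfolding eigen_orthonormal_def
      by (metis of_real_eq_1_iff)
    then have nb: "norm b = 1" using norm_ge_zero[of b] by (simp add: power2_eq_1_iff)
    have l: "l = (norm (projmat V *v (Y *v b)))\<^sup>2"
      using inner[of b] b(2) by (simp add: rayleigh_def)
    have "1 = l + (norm (Y *v b - projmat V *v (Y *v b)))\<^sup>2"
      using projmat_pythagoras[OF V, of "Y *v b"] Y(1) nb by (simp add: l)
    then have sq: "1 - l = (norm (Y *v b - projmat V *v (Y *v b)))\<^sup>2" by simp
    \<comment> \<open>The hypothesis speaks of \<open>W\<close>, the angles of the chosen basis
      \<open>Y\<close>. Both have the same column space, so \<open>Y b\<close> is \<open>W y\<close>
      for a unit vector \<open>y\<close>.\<close>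
    have "Y *v b \<in> colspace W" using Y(2) by (auto simp: colspace_def)
    then obtain y where y: "Y *v b = W *v y" by (auto simp: colspace_def)
    have "norm y = norm (W *v y)" using W by simp
    also have "\<dots> = 1" using Y(1) nb by (simp flip: y)
    finally have ny: "norm y = 1" .
    have "sqrt (1 - l) = norm (W *v y - projmat V *v (W *v y))" by (simp add: sq y)
    also have "\<dots> \<le> t" using le[of y] ny by simp
    finally have "sqrt (1 - l) \<le> t" .
    moreover have "0 \<le> l" by (simp add: l)
    moreover have "0 \<le> 1 - l" unfolding sq by simp
    ultimately show ?thesis by simp
  qed
  have "sin_Theta (colspace V) (colspace W) = (diag_of_list (map (\<lambda>l. sin (arccos (sqrt l))) (eigs N)) :: real^'k^'k)"
    by (simp add: sin_Theta_def canon_angles_def singvals_def N_def X_def Y_def comp_def)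
  also have "norm2 \<dots> \<le> t"
  proof (rule norm2_diag_of_list_le)
    show "length (map (\<lambda>l. sin (arccos (sqrt l))) (eigs N)) = CARD('k)"
      using length_eigs[OF N] by simp
    fix x assume "x \<in> set (map (\<lambda>l. sin (arccos (sqrt l))) (eigs N))"
    then obtain l where l: "l \<in> set (eigs N)" "x = sin (arccos (sqrt l))" by auto
    have "x = sqrt (1 - l)"
      unfolding l(2) using bound[OF l(1)] by (subst sin_arccos) (auto intro: order_trans[of _ 0])
    then show "\<bar>x\<bar> \<le> t" using bound[OF l(1)] by simp
  qed
  finally show ?thesis .
qed

section \<open>The fixed point argument\<close>

lemma norm_matrix_vector_mult_le: "norm (M *v x) \<le> norm M * norm x" for M :: "complex^'m^'n"
proof -
  have "norm ((M *v x) $ i) \<le> norm (M $ i) * norm x" for i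
  proof -
    have "norm ((M *v x) $ i) \<le> (\<Sum>j\<in>UNIV. \<bar>norm (M $ i $ j)\<bar> * \<bar>norm (x $ j)\<bar>)"
      unfolding matrix_vector_mult_def by (auto intro!: norm_sum[THEN order_trans] simp: norm_mult)
    also have "\<dots> \<le> norm (M $ i) * norm x"
      unfolding norm_vec_def by (rule L2_set_mult_ineq)
    finally show ?thesis .
  qed
  then have "norm (M *v x) \<le> L2_set (\<lambda>i. norm (M $ i) * norm x) UNIV"
    unfolding norm_vec_def[of "M *v x"] by (intro L2_set_mono) auto
  also have "\<dots> = norm M * norm x"
    by (simp add: norm_vec_def[of M] L2_set_left_distrib)
  finally show ?thesis .
qed

lemma inner_perturb_le:
  assumes "\<And>x. norm ((H - A) *v x) \<le> r * norm x"
  shows "x \<bullet> (H *v x) \<le> x \<bullet> (A *v x) + r * (norm (x :: complex^'n))\<^sup>2"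
proof -
  have "x \<bullet> (H *v x) = x \<bullet> (A *v x) + x \<bullet> ((H - A) *v x)"
    by (simp add: matrix_vector_mult_diff_rdistrib inner_diff_right)
  also have "x \<bullet> ((H - A) *v x) \<le> norm x * (r * norm x)"
    by (rule order_trans[OF norm_cauchy_schwarz mult_left_mono[OF assms]]) simp
  finally show ?thesis by (simp add: power2_eq_square mult_ac)
qed

lemma norm_diff_mult_vec_commute: "norm ((A - H) *v x) = norm ((H - A) *v (x :: complex^'n))"
  by (simp add: matrix_vector_mult_diff_rdistrib norm_minus_commute)

lemma eig_perturb:
  fixes A H :: "complex^'n^'n"
  assumes "Hermitian A" "Hermitian H" "1 \<le> j" "j \<le> CARD('n)"
    and "\<And>x. norm ((H - A) *v x) \<le> r * norm x"
  shows "\<bar>eig H j - eig A j\<bar> \<le> r"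
proof -
  have "j - 1 < CARD('n)" using assms(3,4) by linarith
  then have "eigs H ! (j - 1) \<le> eigs A ! (j - 1) + r" "eigs A ! (j - 1) \<le> eigs H ! (j - 1) + r"
    using assms(5)
    by (intro eigs_perturb_le assms(1,2) inner_perturb_le; simp add: norm_diff_mult_vec_commute[of A])+
  then show ?thesis by (simp add: eig_def)
qed

text \<open>Davis-Kahan is applied twice with the roles of \<open>A\<close> and \<open>H\<close>
  exchanged. Both directions are needed to compare the projections by
  \<open>projmat_diff_le\<close>.\<close>

lemma lowest_frame_perturb:
  fixes A H :: "complex^'n^'n" and V W :: "complex^'k^'n"
  assumes A: "Hermitian A" "lowest_frame A V" and H: "Hermitian H" "lowest_frame H W"
    and kn: "CARD('k) < CARD('n)"
    and r: "\<And>x. norm ((H - A) *v x) \<le> r * norm x"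
    and c: "0 < c" "c \<le> eig A (CARD('k) + 1) - eig H CARD('k)" "c \<le> eig H (CARD('k) + 1) - eig A CARD('k)"
  shows "norm (W *v y - projmat V *v (W *v y)) \<le> r / c * norm y"
    and "norm (V *v y - projmat W *v (V *v y)) \<le> r / c * norm y"
proof -
  have sc: "u \<le> r / c * norm y" if "b * u \<le> r * norm y" "c \<le> b" "0 \<le> u" for b u
  proof -
    have "c * u \<le> b * u" using that by (intro mult_right_mono) auto
    then show ?thesis using that(1) c(1) by (simp add: field_simps)
  qed
  have V: "V \<in> Vk" "A ** V = V ** (ctranspose V ** A ** V)"
    and W: "W \<in> Vk" "H ** W = W ** (ctranspose W ** H ** W)"
    using A H by (simp_all add: lowest_frame_def)
  have "(eig A (CARD('k) + 1) - eig H CARD('k)) * norm (W *v y - projmat V *v (W *v y)) \<le> r * norm y"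
    by (rule davis_kahan[OF V lowest_frame_lower[OF A(1) kn A(2)] W lowest_frame_upper[OF H(1) kn H(2)] r])
      (use c in auto)
  then show "norm (W *v y - projmat V *v (W *v y)) \<le> r / c * norm y"
    using c(2) by (rule sc) simp
  have "(eig H (CARD('k) + 1) - eig A CARD('k)) * norm (V *v y - projmat W *v (V *v y)) \<le> r * norm y"
    by (rule davis_kahan[OF W lowest_frame_lower[OF H(1) kn H(2)] V lowest_frame_upper[OF A(1) kn A(2)]])
      (use c r in \<open>auto simp: norm_diff_mult_vec_commute[of A]\<close>)
  then show "norm (V *v y - projmat W *v (V *v y)) \<le> r / c * norm y"
    using c(3) by (rule sc) simp
qed

lemma linear_ctranspose: "linear (ctranspose :: complex^'m^'n \<Rightarrow> _)"
  by (rule linearI) (simp_all add: ctranspose_def vec_eq_iff)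

lemma Hermitian_ball_compact_convex:
  fixes A :: "complex^'n^'n"
  shows "compact {H. Hermitian H \<and> (\<forall>x. norm ((H - A) *v x) \<le> r * norm x)}" (is "compact ?K")
    and "convex {H. Hermitian H \<and> (\<forall>x. norm ((H - A) *v x) \<le> r * norm x)}"
proof -
  let ?h = "\<lambda>H :: complex^'n^'n. ctranspose H - H"
  have h: "linear ?h" by (intro linear_compose_sub linear_ctranspose linear_ident)
  have m: "linear (\<lambda>H :: complex^'n^'n. H *v x)" for x
    by (rule linearI) (simp_all add: matrix_vector_mult_add_rdistrib,
        simp add: vec_eq_iff matrix_vector_mult_def scaleR_sum_right)
  \<comment> \<open>As an intersection of preimages of a point and of balls under linear maps, the
    set is visibly closed and convex.\<close>
  have K: "?K = ?h -` {0} \<inter> (\<Inter>x. (\<lambda>H. H *v x) -` cball (A *v x) (r * norm x))"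
    by (auto simp: Hermitian_def dist_norm norm_minus_commute matrix_vector_mult_diff_rdistrib)
  show "convex ?K"
    unfolding K by (intro convex_Int convex_INT convex_linear_vimage h m) auto
  have "closed ?K"
    unfolding K using h m
    by (intro closed_Int closed_INT closed_vimage ballI linear_continuous_on)
      (auto simp: linear_conv_bounded_linear)
  moreover have "bounded ?K"
  proof (rule boundedI)
    fix H assume "H \<in> ?K"
    then have "norm (H - A) \<le> of_nat (CARD('n) * CARD('n)) * r"
      by (intro norm_le_card_bound) simp
    then show "norm H \<le> norm A + of_nat (CARD('n) * CARD('n)) * r"
      using norm_triangle_sub[of H A] by linarith
  qed
  ultimately show "compact ?K" by (simp add: compact_eq_bounded_closed)
qed

text \<open>The neighbourhood of the projection is not convex, hence the detour through a ball of
  Hermitian matrices.\<close>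

lemma NEPv_solution_near:
  fixes A :: "complex^'n^'n" and V\<^sub>0 :: "complex^'k^'n"
  assumes A: "Hermitian A" "lowest_frame A V\<^sub>0" and kn: "CARD('k) < CARD('n)"
    and F: "continuous_on (Pk TYPE('k)) F" "\<And>P. P \<in> Pk TYPE('k) \<Longrightarrow> Hermitian (F P)"
    and g: "g = eig A (CARD('k) + 1) - eig A CARD('k)" and r: "0 \<le> r" "r < g / 2" and t: "t = r / (g - r)"
    and near: "\<And>V x. \<lbrakk>V \<in> Vnbhd V\<^sub>0 t; \<And>x. norm ((projmat V - projmat V\<^sub>0) *v x) \<le> t * norm x\<rbrakk>
        \<Longrightarrow> norm ((F (projmat V) - A) *v x) \<le> r * norm x"
  shows "\<exists>V. NEPv_solution F V \<and> V \<in> Vnbhd V\<^sub>0 t"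
proof -
  define K where "K = {H. Hermitian H \<and> (\<forall>x. norm ((H - A) *v x) \<le> r * norm x)}"
  \<comment> \<open>The frame is an arbitrary choice and need not depend continuously on
    \<open>H\<close>. Only its projection is shown to be continuous.\<close>
  define \<Phi> where "\<Phi> H = (SOME V :: complex^'k^'n. lowest_frame H V)" for H
  have \<Phi>: "lowest_frame H (\<Phi> H)" if "Hermitian H" for H
    unfolding \<Phi>_def by (rule lowest_frame_exists[OF that kn]) (erule someI)
  have KD: "Hermitian H" "norm ((H - A) *v x) \<le> r * norm x" if "H \<in> K" for H x
    using that by (simp_all add: K_def)
  have Vk: "V\<^sub>0 \<in> Vk" "\<And>H. H \<in> K \<Longrightarrow> \<Phi> H \<in> Vk"
    using A(2) \<Phi> KD(1) unfolding lowest_frame_def by blast+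
  have eig: "\<bar>eig H CARD('k) - eig A CARD('k)\<bar> \<le> r"
    "\<bar>eig H (CARD('k) + 1) - eig A (CARD('k) + 1)\<bar> \<le> r" if "H \<in> K" for H
    using kn by (auto intro!: eig_perturb[OF A(1) KD(1)[OF that]] KD(2)[OF that] simp: Suc_le_eq)
  have gr: "g - r > 0" using r by linarith
  have near\<Phi>: "\<Phi> H \<in> Vnbhd V\<^sub>0 t" "norm ((projmat (\<Phi> H) - projmat V\<^sub>0) *v x) \<le> t * norm x"
    if H: "H \<in> K" for H x
  proof -
    \<comment> \<open>Against the centre \<open>A\<close> only one of the two eigenvalues moves,
      which costs \<open>r\<close> once; hence the radius \<open>r / (g - r)\<close>.\<close>
    have gap: "g - r \<le> eig A (CARD('k) + 1) - eig H CARD('k)" "g - r \<le> eig H (CARD('k) + 1) - eig A CARD('k)"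
      using eig[OF H] g by linarith+
    note b = lowest_frame_perturb[OF A KD(1)[OF H] \<Phi>[OF KD(1)[OF H]] kn KD(2)[OF H] gr gap, folded t]
    show "\<Phi> H \<in> Vnbhd V\<^sub>0 t"
      unfolding Vnbhd_def using Vk(2)[OF H] norm2_sin_Theta_le[OF Vk(2)[OF H] Vk(1) b(2)] by blast
    show "norm ((projmat (\<Phi> H) - projmat V\<^sub>0) *v x) \<le> t * norm x"
      using r gr by (intro projmat_diff_le Vk H b) (simp add: t)
  qed
  have Pk: "projmat (\<Phi> H) \<in> Pk TYPE('k)" if "H \<in> K" for H
    using Vk(2)[OF that] by (auto simp: Pk_def)
  \<comment> \<open>For two members of the ball both eigenvalues may move by \<open>r\<close>, so
    the gap left for the Lipschitz estimate is \<open>g - 2 * r\<close>.\<close>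
  define c where "c = g - 2 * r"
  have c: "c > 0" using r by (simp add: c_def)
  have "(of_nat (CARD('n) * CARD('n)) / c)-lipschitz_on K (\<lambda>H. projmat (\<Phi> H))"
  proof (rule lipschitz_onI)
    fix H H' assume H: "H \<in> K" "H' \<in> K"
    have gap: "c \<le> eig H' (CARD('k) + 1) - eig H CARD('k)" "c \<le> eig H (CARD('k) + 1) - eig H' CARD('k)"
      using eig[OF H(1)] eig[OF H(2)] g unfolding c_def by linarith+
    note b = lowest_frame_perturb[OF KD(1)[OF H(2)] \<Phi>[OF KD(1)[OF H(2)]] KD(1)[OF H(1)] \<Phi>[OF KD(1)[OF H(1)]] kn
        norm_matrix_vector_mult_le c gap]
    have "norm (projmat (\<Phi> H) - projmat (\<Phi> H')) \<le> of_nat (CARD('n) * CARD('n)) * (norm (H - H') / c)"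
      using c by (intro norm_le_card_bound projmat_diff_le Vk H b) simp
    then show "dist (projmat (\<Phi> H)) (projmat (\<Phi> H')) \<le> of_nat (CARD('n) * CARD('n)) / c * dist H H'"
      by (simp add: dist_norm)
  qed (use c in simp)
  then have "continuous_on K (\<lambda>H. projmat (\<Phi> H))" by (rule lipschitz_on_continuous_on)
  then have "continuous_on K (\<lambda>H. F (projmat (\<Phi> H)))"
    by (rule continuous_on_compose2[OF F(1)]) (use Pk in auto)
  moreover have "(\<lambda>H. F (projmat (\<Phi> H))) \<in> K \<rightarrow> K"
  proof
    fix H assume H: "H \<in> K"
    show "F (projmat (\<Phi> H)) \<in> K"
      unfolding K_def using F(2)[OF Pk[OF H]] near[OF near\<Phi>[OF H]] by blast
  qed
  moreover have "compact K" "convex K"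
    unfolding K_def by (rule Hermitian_ball_compact_convex)+
  moreover have "A \<in> K" using A(1) r(1) by (simp add: K_def)
  then have "K \<noteq> {}" by blast
  ultimately obtain H where H: "H \<in> K" "F (projmat (\<Phi> H)) = H"
    using brouwer[of K "\<lambda>H. F (projmat (\<Phi> H))"] by blast
  have "NEPv_solution F (\<Phi> H)"
    unfolding NEPv_solution_iff H(2) by (rule \<Phi>[OF KD(1)[OF H(1)]])
  then show ?thesis using near\<Phi>(1)[OF H(1)] by blast
qed

section \<open>The radius, and bounds drawn from the suprema\<close>

text \<open>The equation \<open>t = r / (g - r)\<close> with \<open>r = \<delta> + d * t\<close>
  amounts to \<open>d * t\<^sup>2 - (g - d - \<delta>) * t + \<delta> = 0\<close>. The given
  \<open>t\<close> is its smaller root in rationalised form, which remains meaningful for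
  \<open>d = 0\<close>.\<close>

lemma radius_properties:
  fixes d g \<delta> t :: real
  assumes "0 \<le> d" "0 \<le> \<delta>" "\<delta> < g / 2 - d"
    and t: "t = 2 * \<delta> / (g - d - \<delta> + sqrt ((g - d - \<delta>)\<^sup>2 - 4 * d * \<delta>))"
  shows "0 \<le> t" "t \<le> 1" "t = (\<delta> + d * t) / (g - (\<delta> + d * t))"
proof -
  define m where "m = g - d - \<delta>"
  define s where "s = sqrt (m\<^sup>2 - 4 * d * \<delta>)"
  have m: "m > \<delta> + d" using assms(3) by (simp add: m_def)
  \<comment> \<open>Since \<open>m > \<delta> + d\<close>, the discriminant is at least
    \<open>(\<delta> - d)\<^sup>2\<close>. So the root \<open>s\<close> is real, and
    \<open>m + s \<ge> 2 * \<delta>\<close>, that is, \<open>t \<le> 1\<close>.\<close>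
  have "(\<delta> - d)\<^sup>2 = (\<delta> + d)\<^sup>2 - 4 * d * \<delta>" by (simp add: power2_eq_square algebra_simps)
  also have "\<dots> \<le> m\<^sup>2 - 4 * d * \<delta>"
    using power_mono[of "\<delta> + d" m 2] m assms(1,2) by simp
  finally have disc: "(\<delta> - d)\<^sup>2 \<le> m\<^sup>2 - 4 * d * \<delta>" .
  then have s2: "s\<^sup>2 = m\<^sup>2 - 4 * d * \<delta>"
    unfolding s_def by (intro real_sqrt_pow2) (rule order_trans[OF zero_le_power2])
  have s: "\<bar>\<delta> - d\<bar> \<le> s" using real_sqrt_le_mono[OF disc] by (simp add: s_def)
  have pos: "m + s > 0" "2 * \<delta> \<le> m + s" using m s assms(1,2) by linarith+
  have t': "t = 2 * \<delta> / (m + s)" by (simp add: t m_def s_def)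
  show t0: "0 \<le> t" "t \<le> 1" using pos assms(2) by (simp_all add: t')
  have ms: "t * (m + s) = 2 * \<delta>" using pos by (simp add: t')
  have "(d * t\<^sup>2 - m * t + \<delta>) * (m + s)\<^sup>2 = d * (t * (m + s))\<^sup>2 - m * (t * (m + s)) * (m + s) + \<delta> * (m + s)\<^sup>2"
    by (simp add: power2_eq_square algebra_simps)
  also have "\<dots> = \<delta> * (4 * d * \<delta> - m\<^sup>2 + s\<^sup>2)"
    unfolding ms by (simp add: power2_eq_square algebra_simps)
  also have "\<dots> = 0" by (simp add: s2)
  finally have quad: "d * t\<^sup>2 - m * t + \<delta> = 0" using pos(1) by simp
  have "d * t \<le> d" using t0 assms(1) mult_left_mono[of t 1 d] by simp
  then have "g - (\<delta> + d * t) > 0" using assms by linarith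
  moreover have "t * (g - (\<delta> + d * t)) = \<delta> + d * t"
    using quad by (simp add: m_def power2_eq_square algebra_simps)
  ultimately show "t = (\<delta> + d * t) / (g - (\<delta> + d * t))" by (simp only: eq_divide_eq) simp
qed

text \<open>An infinite summand would make the sum infinite. This is how the real values
  \<open>\<delta>\<close> and \<open>d\<close> in the theorem force every supremum to be
  finite.\<close>

lemma ereal_sum_split:
  assumes "ereal c = x + y"
  obtains a b where "x = ereal a" "y = ereal b" "c = a + b"
  using assms by (cases x; cases y) auto

lemma sup_diff_bound: "sup_diff S F G = ereal a \<Longrightarrow> P \<in> S \<Longrightarrow> norm2 (F P - G P) \<le> a"
  using SUP_upper[of P S "\<lambda>P. ereal (norm2 (F P - G P))"] unfolding sup_diff_def by simp

lemma sup_quot_bound: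
  fixes F :: "complex^'n^'n \<Rightarrow> complex^'n^'n"
  assumes "sup_quot S F Q = ereal a"
  shows "0 \<le> a" and "P \<in> S \<Longrightarrow> norm2 (F P - F Q) \<le> a * norm2 (P - Q)"
proof -
  have le: "norm2 (F P - F Q) / norm2 (P - Q) \<le> a" if "P \<in> S" "P \<noteq> Q" for P
  proof -
    have "ereal (norm2 (F P - F Q) / norm2 (P - Q)) \<le> sup_quot S F Q"
      unfolding sup_quot_def using that by (intro SUP_upper) auto
    then show ?thesis by (simp add: assms)
  qed
  \<comment> \<open>The supremum of the empty set is minus infinity, which a real value
    \<open>a\<close> rules out. Some quotient therefore exists, and it is nonnegative.\<close>
  have "S - {Q} \<noteq> {}"
  proof
    assume "S - {Q} = {}"
    then have "sup_quot S F Q = - \<infinity>" unfolding sup_quot_def by (simp only: image_empty Sup_empty bot_ereal_def)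
    then show False using assms by simp
  qed
  then obtain P\<^sub>1 where "P\<^sub>1 \<in> S" "P\<^sub>1 \<noteq> Q" by blast
  from le[OF this] show "0 \<le> a"
    by (rule order_trans[rotated]) (simp add: norm2_nonneg)
  show "norm2 (F P - F Q) \<le> a * norm2 (P - Q)" if "P \<in> S"
  proof (cases "P = Q")
    case True
    have "norm2 (0 :: complex^'n^'n) \<le> 0" by (rule norm2_le) simp
    then have "norm2 (0 :: complex^'n^'n) = 0" using norm2_nonneg[of "0 :: complex^'n^'n"] by simp
    with True show ?thesis by simp
  next
    case False
    then show ?thesis using le[OF that False] norm2_pos[of "P - Q"] by (simp add: field_simps)
  qed
qed

theorem theorem2p1:
  fixes A0 At0 :: "complex^'n^'n"
    and A1 A2 At1 At2 A At :: "complex^'n^'n \<Rightarrow> complex^'n^'n"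
    and Vs :: "complex^'k^'n" and Ps :: "complex^'n^'n"
    and g \<xi> \<delta> d \<xi>s :: real
  assumes "CARD('k) < CARD('n)"
    and "Hermitian A0"
    and "\<And>P. P \<in> Pk TYPE('k) \<Longrightarrow> Hermitian (A1 P)" and "linear A1"
    and "\<And>P. P \<in> Pk TYPE('k) \<Longrightarrow> Hermitian (A2 P)"
    and "A = (\<lambda>P. A0 + A1 P + A2 P)" and "continuous_on (Pk TYPE('k)) A"
    and "Hermitian At0"
    and "\<And>P. P \<in> Pk TYPE('k) \<Longrightarrow> Hermitian (At1 P)"
    and "\<And>P. P \<in> Pk TYPE('k) \<Longrightarrow> Hermitian (At2 P)"
    and "At = (\<lambda>P. At0 + At1 P + At2 P)" and "continuous_on (Pk TYPE('k)) At"
    and "NEPv_solution A Vs" and "Ps = projmat Vs"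
    and "g = eig (A Ps) (CARD('k) + 1) - eig (A Ps) CARD('k)" and "g > 0"
    and "\<xi> > 0"
    and "ereal \<delta> = ereal (norm2 (At0 - A0)) + sup_diff (Pnbhd Vs \<xi>) At1 A1 + sup_diff (Pnbhd Vs \<xi>) At2 A2"
    and "ereal d = sup_quot (Pnbhd Vs \<xi>) A1 Ps + sup_quot (Pnbhd Vs \<xi>) A2 Ps"
    and "\<delta> < g / 2 - d"
    and "\<xi>s = 2 * \<delta> / (g - d - \<delta> + sqrt ((g - d - \<delta>)\<^sup>2 - 4 * d * \<delta>))"
    and "\<xi>s \<le> \<xi>"
  shows "\<exists>Vts. NEPv_solution At Vts \<and> Vts \<in> Vnbhd Vs \<xi>s"
proof -
  note defA = \<open>A = (\<lambda>P. A0 + A1 P + A2 P)\<close> and defAt = \<open>At = (\<lambda>P. At0 + At1 P + At2 P)\<close>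
  have sol: "lowest_frame (A Ps) Vs"
    using \<open>NEPv_solution A Vs\<close> \<open>Ps = projmat Vs\<close> by (simp add: NEPv_solution_iff)
  then have Vs: "Vs \<in> Vk" by (simp add: lowest_frame_def)
  have Herm_add: "Hermitian (M + N)" if "Hermitian M" "Hermitian N" for M N :: "complex^'n^'n"
    using that linear_add[OF linear_ctranspose, of M N] by (simp add: Hermitian_def)
  have HermA: "Hermitian (A Ps)"
    using assms(2,3,5) Vs unfolding defA \<open>Ps = projmat Vs\<close> by (auto intro!: Herm_add simp: Pk_def)
  have HermAt: "Hermitian (At P)" if "P \<in> Pk TYPE('k)" for P
    using assms(8-10) that unfolding defAt by (auto intro!: Herm_add)
  let ?S = "Pnbhd Vs \<xi>"
  \<comment> \<open>The neighbourhood contains its centre, so the suprema of the differences are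
    taken over a nonempty set and are nonnegative.\<close>
  have "Vs \<in> Vnbhd Vs \<xi>"
    using \<open>\<xi> > 0\<close> Vs by (auto simp: Vnbhd_def intro!: norm2_sin_Theta_le)
  then have Ps: "Ps \<in> ?S" by (simp add: \<open>Ps = projmat Vs\<close> Pnbhd_def)
  obtain c \<delta>\<^sub>2 where "ereal (norm2 (At0 - A0)) + sup_diff ?S At1 A1 = ereal c"
    and \<delta>2: "sup_diff ?S At2 A2 = ereal \<delta>\<^sub>2" and c: "\<delta> = c + \<delta>\<^sub>2"
    using ereal_sum_split[OF assms(18)] .
  from this(1)[symmetric] obtain a \<delta>\<^sub>1 where "ereal (norm2 (At0 - A0)) = ereal a"
    and \<delta>1: "sup_diff ?S At1 A1 = ereal \<delta>\<^sub>1" and "c = a + \<delta>\<^sub>1"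
    by (rule ereal_sum_split)
  with c have \<delta>: "\<delta> = norm2 (At0 - A0) + \<delta>\<^sub>1 + \<delta>\<^sub>2" by simp
  obtain d\<^sub>1 d\<^sub>2 where d1: "sup_quot ?S A1 Ps = ereal d\<^sub>1" and d2: "sup_quot ?S A2 Ps = ereal d\<^sub>2"
    and d: "d = d\<^sub>1 + d\<^sub>2"
    using ereal_sum_split[OF assms(19)] .
  have d0: "0 \<le> d" using sup_quot_bound(1)[OF d1] sup_quot_bound(1)[OF d2] d by simp
  have "0 \<le> \<delta>\<^sub>1" "0 \<le> \<delta>\<^sub>2"
    using sup_diff_bound[OF \<delta>1 Ps] sup_diff_bound[OF \<delta>2 Ps]
      norm2_nonneg[of "At1 Ps - A1 Ps"] norm2_nonneg[of "At2 Ps - A2 Ps"] by linarith+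
  then have \<delta>0: "0 \<le> \<delta>" using \<delta> norm2_nonneg[of "At0 - A0"] by linarith
  note rad = radius_properties[OF d0 \<delta>0 assms(20,21)]
  let ?r = "\<delta> + d * \<xi>s"
  \<comment> \<open>As \<open>\<xi>s \<le> 1\<close>, the ball radius is at most
    \<open>\<delta> + d\<close>, which is below \<open>g / 2\<close> by hypothesis.\<close>
  have "d * \<xi>s \<le> d" using rad d0 mult_left_mono[of \<xi>s 1 d] by simp
  then have r: "0 \<le> ?r" "?r < g / 2" using rad d0 \<delta>0 assms(20) by simp_all
  show ?thesis
  proof (rule NEPv_solution_near[OF HermA sol \<open>CARD('k) < CARD('n)\<close>
        \<open>continuous_on (Pk TYPE('k)) At\<close> HermAt assms(15) r rad(3)])
    fix V x
    assume V: "V \<in> Vnbhd Vs \<xi>s" and diff: "\<And>x. norm ((projmat V - projmat Vs) *v x) \<le> \<xi>s * norm x"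
    define P where "P = projmat V"
    \<comment> \<open>Here \<open>\<xi>s \<le> \<xi>\<close> enters: the suprema control only
      projections in the \<open>\<xi>\<close>-neighbourhood.\<close>
    have P: "P \<in> ?S" using V \<open>\<xi>s \<le> \<xi>\<close> by (force simp: P_def Pnbhd_def Vnbhd_def)
    have "norm2 (P - Ps) \<le> \<xi>s"
      unfolding P_def \<open>Ps = projmat Vs\<close> using diff by (rule norm2_le)
    then have le: "d\<^sub>i * norm2 (P - Ps) \<le> d\<^sub>i * \<xi>s" if "0 \<le> d\<^sub>i" for d\<^sub>i
      using that by (rule mult_left_mono)
    have bound: "norm (M *v x) \<le> b * norm x" if "norm2 M \<le> b" for M :: "complex^'n^'n" and b
      using norm2_bound[of M x] mult_right_mono[OF that norm_ge_zero[of x]] by linarith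
    have q: "norm2 (A1 P - A1 Ps) \<le> d\<^sub>1 * \<xi>s" "norm2 (A2 P - A2 Ps) \<le> d\<^sub>2 * \<xi>s"
      using sup_quot_bound[OF d1] sup_quot_bound[OF d2] P le by (meson order_trans)+
    \<comment> \<open>Three terms compare the two problems at the same \<open>P\<close> and sum to
      \<open>\<delta>\<close>; the other two move the original problem from \<open>P\<close> to
      \<open>Ps\<close> and cost \<open>d * \<xi>s\<close>.\<close>
    have "(At P - A Ps) *v x = (At0 - A0) *v x + (At1 P - A1 P) *v x + (At2 P - A2 P) *v x
        + (A1 P - A1 Ps) *v x + (A2 P - A2 Ps) *v x"
      by (simp add: defA defAt matrix_vector_mult_add_rdistrib matrix_vector_mult_diff_rdistrib)
    also have "norm \<dots> \<le> norm2 (At0 - A0) * norm x + \<delta>\<^sub>1 * norm x + \<delta>\<^sub>2 * norm x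
        + d\<^sub>1 * \<xi>s * norm x + d\<^sub>2 * \<xi>s * norm x"
      by (intro norm_triangle_mono bound q sup_diff_bound[OF \<delta>1 P] sup_diff_bound[OF \<delta>2 P] order_refl)
    also have "\<dots> = ?r * norm x" by (simp add: \<delta> d algebra_simps)
    finally show "norm ((At (projmat V) - A Ps) *v x) \<le> ?r * norm x" by (simp add: P_def)
  qed
qed

end
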